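(* Let $\alpha\in(0,1)$, $C\ge2$, $\rho_0\in[0,1]$, and $\Phi(c_{\alpha/2})=1-\alpha/2$. Let $S$ be a (random) sampling procedure allocating data to $C$ tests such that, under the global null and conditionally on the draw of $S$, the test statistics $(T_1,\dots,T_C)$ are jointly normal with $T_i\sim\mathcal N(0,1)$ and pairwise correlations $\rho_{ij}$ (which depend on the draw of $S$). Let $R_i=\{|T_i|>c_{\alpha/2}\}$ and $E=\sum_{i=1}^C\mathbf 1_{R_i}$. Suppose that for all $i\ne j$, $$\mathbb P_S(|\rho_{ij}|\ge\rho_0)\le w.$$ Then $$\mathbb E_S[\mathbb V(E)]\le C\alpha(1-\alpha)+C(C-1)\left[\alpha(1-\alpha)\,w+R(\rho_0,c_{\alpha/2})\right],$$ where $R(\rho_0,c_{\alpha/2})=2\left[\Phi_{\rho_0}(c_{\alpha/2},c_{\alpha/2})+\Phi_{-\rho_0}(c_{\alpha/2},c_{\alpha/2})-2\Phi(c_{\alpha/2})^2\right]$. In particular, if $w=\gamma/\binom C2$, then $$\mathbb E_S[\mathbb V(E)]\le(C+2\gamma)\alpha(1-\alpha)+C(C-1)R(\rho_0,c_{\alpha/2}).$$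
   Context: $\Phi$ is the standard normal CDF and $\Phi_\rho(x,y)$ the CDF of the bivariate normal law with zero means, unit variances and correlation $\rho$ (degenerate if $|\rho|=1$). $\mathbb V(E)$ denotes the conditional variance of $E$ given the draw of $S$, and $\mathbb E_S,\mathbb P_S$ are expectation and probability over the draw of $S$. *)

theory Defs
  imports "HOL-Probability.Probability"
begin

subsection \<open>Normal laws\<close>

definition Phi :: "real \<Rightarrow> real" where
  "Phi x = cdf std_normal_distribution x"

text \<open>The normal law with mean \<open>\<mu>\<close> and standard deviation \<open>\<sigma> \<ge> 0\<close>. The degenerate case
  is separate because \<open>normal_density \<mu> 0\<close> vanishes identically.\<close>

definition normal_law :: "real \<Rightarrow> real \<Rightarrow> real measure" where
  "normal_law \<mu> \<sigma> =
     (if \<sigma> = 0 then return borel \<mu> else density lborel (normal_density \<mu> \<sigma>))"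

text \<open>Joint normality, singular covariance matrices included: every linear combination is
  (possibly degenerate) normal.\<close>

definition jointly_normal :: "'a measure \<Rightarrow> 'i set \<Rightarrow> ('i \<Rightarrow> 'a \<Rightarrow> real) \<Rightarrow> bool" where
  "jointly_normal M I X \<longleftrightarrow>
     (\<forall>i\<in>I. X i \<in> borel_measurable M) \<and>
     (\<forall>a. \<exists>\<mu> \<sigma>. 0 \<le> \<sigma> \<and> distr M borel (\<lambda>\<omega>. \<Sum>i\<in>I. a i * X i \<omega>) = normal_law \<mu> \<sigma>)"

definition covariance :: "'a measure \<Rightarrow> ('a \<Rightarrow> real) \<Rightarrow> ('a \<Rightarrow> real) \<Rightarrow> real" where
  "covariance M X Y =
     (LINT \<omega>|M. (X \<omega> - integral\<^sup>L M X) * (Y \<omega> - integral\<^sup>L M Y))"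

definition correlation :: "'a measure \<Rightarrow> ('a \<Rightarrow> real) \<Rightarrow> ('a \<Rightarrow> real) \<Rightarrow> real" where
  "correlation M X Y =
     covariance M X Y / (sqrt (covariance M X X) * sqrt (covariance M Y Y))"

text \<open>The bivariate normal law with zero means, unit variances and correlation
  \<open>\<rho> \<in> [-1, 1]\<close>, as the law of \<open>(Z, \<rho> Z + sqrt (1 - \<rho>\<^sup>2) Z')\<close> for independent standard
  normal \<open>Z\<close>, \<open>Z'\<close>; this covers \<open>\<bar>\<rho>\<bar> = 1\<close>, where there is no density.\<close>

definition bivariate_std_normal :: "real \<Rightarrow> (real \<times> real) measure" where
  "bivariate_std_normal \<rho> =
     distr (std_normal_distribution \<Otimes>\<^sub>M std_normal_distribution) (borel \<Otimes>\<^sub>M borel)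
       (\<lambda>(z, z'). (z, \<rho> * z + sqrt (1 - \<rho>\<^sup>2) * z'))"

definition Phi2 :: "real \<Rightarrow> real \<Rightarrow> real \<Rightarrow> real" where
  "Phi2 \<rho> x y = measure (bivariate_std_normal \<rho>) ({..x} \<times> {..y})"

definition R_term :: "real \<Rightarrow> real \<Rightarrow> real" where
  "R_term \<rho> c = 2 * (Phi2 \<rho> c c + Phi2 (- \<rho>) c c - 2 * (Phi c)\<^sup>2)"

lemma prob_space_std_normal: "prob_space std_normal_distribution"
  by (rule prob_space_normal_density) simp

lemma normal_law_0_eq_distr:
  assumes "0 \<le> \<sigma>"
  shows "normal_law 0 \<sigma> = distr std_normal_distribution borel (\<lambda>x. \<sigma> * x)"
proof (cases "\<sigma> = 0")
  case True
  interpret prob_space std_normal_distribution by (rule prob_space_std_normal)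
  show ?thesis
    using True distr_const[of 0 borel] by (simp add: normal_law_def)
next
  case False
  interpret prob_space std_normal_distribution by (rule prob_space_std_normal)
  have "distributed std_normal_distribution lborel (\<lambda>x. x) std_normal_density"
    by (simp add: distributed_def distr_id2)
  from normal_density_affine[OF this, of \<sigma> 0] False assms
  have "distributed std_normal_distribution lborel (\<lambda>x. \<sigma> * x) (normal_density 0 \<sigma>)"
    by simp
  then have "distr std_normal_distribution lborel (\<lambda>x. \<sigma> * x) = density lborel (normal_density 0 \<sigma>)"
    by (simp add: distributed_def)
  then show ?thesis
    using False by (simp add: normal_law_def cong: distr_cong)
qed

lemma std_normal_pair_combination:
  "distr (std_normal_distribution \<Otimes>\<^sub>M std_normal_distribution) borel (\<lambda>(x, y). u * x + v * y) =
     normal_law 0 (sqrt (u\<^sup>2 + v\<^sup>2))" (is "?L = _")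
proof -
  let ?G = std_normal_distribution
  interpret G: prob_space ?G by (rule prob_space_std_normal)
  interpret P: pair_prob_space ?G ?G ..
  have 0: "real_distribution ?L"
    by (intro real_distribution.intro P.prob_space_distr real_distribution_axioms.intro) auto
  have s: "0 \<le> sqrt (u\<^sup>2 + v\<^sup>2)" by simp
  have 1: "real_distribution (normal_law 0 (sqrt (u\<^sup>2 + v\<^sup>2)))"
    unfolding normal_law_0_eq_distr[OF s]
    by (intro real_distribution.intro G.prob_space_distr real_distribution_axioms.intro) auto
  have c: "(CLINT x|?G. iexp (t * x)) = exp (- (t\<^sup>2) / 2)" for t
    using fun_cong[OF char_std_normal_distribution, of t] by (simp add: char_def)
  have "char ?L t = char (normal_law 0 (sqrt (u\<^sup>2 + v\<^sup>2))) t" for t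
  proof -
    have "char ?L t = (CLINT z|(?G \<Otimes>\<^sub>M ?G). iexp (t * (case z of (x, y) \<Rightarrow> u * x + v * y)))"
      unfolding char_def by (subst integral_distr) auto
    also have "\<dots> = (CLINT z|(?G \<Otimes>\<^sub>M ?G). (case z of (x, y) \<Rightarrow> iexp ((t * u) * x) * iexp ((t * v) * y)))"
      by (intro Bochner_Integration.integral_cong) (auto simp: exp_add[symmetric] algebra_simps)
    also have "\<dots> = (CLINT x|?G. CLINT y|?G. iexp ((t * u) * x) * iexp ((t * v) * y))"
      by (subst P.integral_fst'[symmetric])
         (auto intro!: P.integrable_const_bound[where B=1] simp: norm_mult split_beta)
    also have "\<dots> = exp (- ((t * u)\<^sup>2) / 2) * exp (- ((t * v)\<^sup>2) / 2)"
      unfolding integral_mult_right_zero integral_mult_left_zero c by (rule of_real_mult[symmetric])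
    also have "\<dots> = exp (- ((t * sqrt (u\<^sup>2 + v\<^sup>2))\<^sup>2) / 2)"
    proof -
      have "- ((t * u)\<^sup>2) / 2 + - ((t * v)\<^sup>2) / 2 = - ((t * sqrt (u\<^sup>2 + v\<^sup>2))\<^sup>2) / 2"
        by (simp add: power_mult_distrib field_simps)
      then show ?thesis by (simp only: exp_add[symmetric])
    qed
    also have "\<dots> = char (normal_law 0 (sqrt (u\<^sup>2 + v\<^sup>2))) t"
      unfolding normal_law_0_eq_distr[OF s] char_def
      by (subst integral_distr, simp, simp) (simp only: mult.assoc[symmetric] c)
    finally show ?thesis .
  qed
  then show ?thesis using Levy_uniqueness[OF 0 1] by auto
qed

text \<open>\<open>bivariate_std_normal \<rho>\<close> is jointly normal with standard margins and correlation \<open>\<rho>\<close>.\<close>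

lemma bivariate_std_normal_jointly_normal:
  "jointly_normal (bivariate_std_normal \<rho>) {True, False} (\<lambda>b. if b then fst else snd)"
  unfolding jointly_normal_def
proof (intro conjI allI)
  fix a :: "bool \<Rightarrow> real"
  let ?u = "a True + a False * \<rho>" and ?v = "a False * sqrt (1 - \<rho>\<^sup>2)"
  have "distr (bivariate_std_normal \<rho>) borel
      (\<lambda>\<omega>. \<Sum>i\<in>{True, False}. a i * (if i then fst else snd) \<omega>) =
      distr (std_normal_distribution \<Otimes>\<^sub>M std_normal_distribution) borel (\<lambda>(x, y). ?u * x + ?v * y)"
    unfolding bivariate_std_normal_def
    by (subst distr_distr) (auto intro!: distr_cong simp: algebra_simps)
  then show "\<exists>\<mu> \<sigma>. 0 \<le> \<sigma> \<and> distr (bivariate_std_normal \<rho>) borel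
      (\<lambda>\<omega>. \<Sum>i\<in>{True, False}. a i * (if i then fst else snd) \<omega>) = normal_law \<mu> \<sigma>"
    unfolding std_normal_pair_combination by (metis real_sqrt_ge_zero sum_power2_ge_zero)
qed (auto simp: bivariate_std_normal_def)

lemma bivariate_std_normal_marginals:
  assumes "\<bar>\<rho>\<bar> \<le> 1"
  shows "distr (bivariate_std_normal \<rho>) borel fst = std_normal_distribution"
    and "distr (bivariate_std_normal \<rho>) borel snd = std_normal_distribution"
proof -
  let ?P = "std_normal_distribution \<Otimes>\<^sub>M std_normal_distribution"
  have r: "\<rho>\<^sup>2 \<le> 1" using assms by (simp add: abs_square_le_1)
  have "distr (bivariate_std_normal \<rho>) borel fst = distr ?P borel (\<lambda>(x, y). 1 * x + 0 * y)"
    unfolding bivariate_std_normal_def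
    by (subst distr_distr) (auto intro!: distr_cong)
  then show "distr (bivariate_std_normal \<rho>) borel fst = std_normal_distribution"
    unfolding std_normal_pair_combination by (simp add: normal_law_def)
  have "distr (bivariate_std_normal \<rho>) borel snd =
      distr ?P borel (\<lambda>(x, y). \<rho> * x + sqrt (1 - \<rho>\<^sup>2) * y)"
    unfolding bivariate_std_normal_def
    by (subst distr_distr) (auto intro!: distr_cong)
  then show "distr (bivariate_std_normal \<rho>) borel snd = std_normal_distribution"
    unfolding std_normal_pair_combination using r by (simp add: normal_law_def)
qed

lemma bivariate_std_normal_correlation:
  assumes "\<bar>\<rho>\<bar> \<le> 1"
  shows "correlation (bivariate_std_normal \<rho>) fst snd = \<rho>"
proof -
  let ?G = std_normal_distribution
  interpret G: prob_space ?G by (rule prob_space_std_normal)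
  interpret P: pair_prob_space ?G ?G ..
  let ?B = "bivariate_std_normal \<rho>"
  have m: "(LINT x|?G. x) = 0" "(LINT x|?G. x * x) = 1"
    using integral_std_normal_distribution_moment_odd[of 1]
      std_normal_distribution_even_moments(1)[of 1] by (auto simp: power2_eq_square)
  have i: "integrable ?G (\<lambda>x. x)" "integrable ?G (\<lambda>x. x * x)"
    using integrable_std_normal_distribution_moment[of 1]
      integrable_std_normal_distribution_moment[of 2] by (auto simp: power2_eq_square)
  have meas: "fst \<in> borel_measurable ?B" "snd \<in> borel_measurable ?B"
    by (auto simp: bivariate_std_normal_def)
  have e1: "(LINT z|?B. f (fst z)) = (LINT x|?G. f x)" if "f \<in> borel_measurable borel" for f :: "real \<Rightarrow> real"
    using integral_distr[OF meas(1), of f] that bivariate_std_normal_marginals(1)[OF assms] by simp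
  have e2: "(LINT z|?B. f (snd z)) = (LINT x|?G. f x)" if "f \<in> borel_measurable borel" for f :: "real \<Rightarrow> real"
    using integral_distr[OF meas(2), of f] that bivariate_std_normal_marginals(2)[OF assms] by simp
  have mean: "integral\<^sup>L ?B fst = 0" "integral\<^sup>L ?B snd = 0"
    using e1[of "\<lambda>x. x"] e2[of "\<lambda>x. x"] m by auto
  have var: "covariance ?B fst fst = 1" "covariance ?B snd snd = 1"
    using e1[of "\<lambda>x. x * x"] e2[of "\<lambda>x. x * x"] m by (auto simp: covariance_def mean)
  have ia: "integrable (?G \<Otimes>\<^sub>M ?G) (\<lambda>z. fst z * fst z)"
  proof (rule P.Fubini_integrable)
    have "G.prob UNIV = 1" using G.prob_space by simp
    then show "integrable ?G (\<lambda>x. LINT y|?G. norm (fst (x, y) * fst (x, y)))"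
      by (simp add: i)
  qed simp_all
  have ib: "integrable (?G \<Otimes>\<^sub>M ?G) (\<lambda>z. fst z * snd z)"
    by (intro P.Fubini_integrable) (auto simp: i abs_mult)
  have "covariance ?B fst snd = (LINT z|(?G \<Otimes>\<^sub>M ?G). fst z * (\<rho> * fst z + sqrt (1 - \<rho>\<^sup>2) * snd z))"
    unfolding covariance_def mean unfolding bivariate_std_normal_def
    by (subst integral_distr) (auto simp: split_beta)
  also have "\<dots> = (LINT z|(?G \<Otimes>\<^sub>M ?G). \<rho> * (fst z * fst z) + sqrt (1 - \<rho>\<^sup>2) * (fst z * snd z))"
    by (simp add: algebra_simps)
  also have "\<dots> = \<rho> * (LINT z|(?G \<Otimes>\<^sub>M ?G). fst z * fst z) + sqrt (1 - \<rho>\<^sup>2) * (LINT z|(?G \<Otimes>\<^sub>M ?G). fst z * snd z)"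
    by (subst Bochner_Integration.integral_add) (use ia ib in auto)
  also have "(LINT z|(?G \<Otimes>\<^sub>M ?G). fst z * fst z) = 1"
    using P.integral_fst'[OF ia] m G.prob_space by simp
  also have "(LINT z|(?G \<Otimes>\<^sub>M ?G). fst z * snd z) = 0"
    using P.integral_fst'[OF ib] m by simp
  finally show ?thesis by (simp add: correlation_def var)
qed

subsection \<open>Conditioning on the draw of a random element\<close>

definition sigma_gen :: "'a measure \<Rightarrow> 's measure \<Rightarrow> ('a \<Rightarrow> 's) \<Rightarrow> 'a measure" where
  "sigma_gen M N S = vimage_algebra (space M) S N"

definition cond_variance ::
    "'a measure \<Rightarrow> 's measure \<Rightarrow> ('a \<Rightarrow> 's) \<Rightarrow> ('a \<Rightarrow> real) \<Rightarrow> 'a \<Rightarrow> real" where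
  "cond_variance M N S X =
     real_cond_exp M (sigma_gen M N S)
       (\<lambda>\<omega>. (X \<omega> - real_cond_exp M (sigma_gen M N S) X \<omega>)\<^sup>2)"

text \<open>\<open>K\<close> is a regular conditional distribution of the random element \<open>X\<close> of \<open>L\<close> given \<open>S\<close>:
  \<open>K s\<close> is the law of \<open>X\<close> conditionally on the draw \<open>S = s\<close>.\<close>

definition regular_cond_distr ::
    "'a measure \<Rightarrow> 's measure \<Rightarrow> ('a \<Rightarrow> 's) \<Rightarrow> 'b measure \<Rightarrow> ('a \<Rightarrow> 'b) \<Rightarrow>
     ('s \<Rightarrow> 'b measure) \<Rightarrow> bool" where
  "regular_cond_distr M N S L X K \<longleftrightarrow>
     K \<in> N \<rightarrow>\<^sub>M prob_algebra L \<and>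
     (\<forall>B\<in>sets L. AE \<omega> in M.
        real_cond_exp M (sigma_gen M N S) (indicator (X -` B \<inter> space M)) \<omega> =
        measure (K (S \<omega>)) B)"

subsection \<open>The tests\<close>

definition rejection :: "'a measure \<Rightarrow> (nat \<Rightarrow> 'a \<Rightarrow> real) \<Rightarrow> real \<Rightarrow> nat \<Rightarrow> 'a set" where
  "rejection M T c i = {\<omega> \<in> space M. \<bar>T i \<omega>\<bar> > c}"

definition num_rejections :: "'a measure \<Rightarrow> nat \<Rightarrow> (nat \<Rightarrow> 'a \<Rightarrow> real) \<Rightarrow> real \<Rightarrow> 'a \<Rightarrow> real" where
  "num_rejections M C T c \<omega> = (\<Sum>i=1..C. indicator (rejection M T c i) \<omega>)"

end

theory Submission
  imports Defs
begin

text \<open>Almost surely \<open>E\<close> has conditional mean \<open>C \<alpha>\<close>, so \<open>\<V>(E)\<close> integrates to a sum over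
  pairs of the covariances of rejection events. For a pair with correlation \<open>\<rho>\<close> the conditional
  covariance is \<open>R(\<rho>, c)\<close>, by the Cramer-Wold device and the symmetries of the bivariate normal
  law. It is at most \<open>\<alpha>(1 - \<alpha>)\<close>, and \<open>R(\<cdot>, c)\<close> is even and nondecreasing in \<open>\<bar>\<rho>\<bar>\<close>, so it is at
  most \<open>R(\<rho>\<^sub>0, c)\<close> when \<open>\<bar>\<rho>\<bar> < \<rho>\<^sub>0\<close>.

  Monotonicity comes from the Ornstein-Uhlenbeck operators \<open>Q\<^sub>r\<close>, which are symmetric contractions
  of \<open>L\<^sup>2\<close> with \<open>Q\<^sub>a Q\<^sub>b = Q\<^bsub>ab\<^esub>\<close>: for \<open>0 \<le> \<rho>\<close> one has
  \<open>\<E> f(X) f(Y) = \<langle>f, Q\<^sub>\<rho> f\<rangle> = \<parallel>Q\<^bsub>\<surd>\<rho>\<^esub> f\<parallel>\<^sup>2\<close>.\<close>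

subsection \<open>The Cramer-Wold device in the plane\<close>

text \<open>Both total masses are the transform at 0, hence agree. Dividing by this common mass
  \<open>m\<close> reduces the claim to Levy uniqueness for probability laws; if
  \<open>m = 0\<close> both measures vanish. The extension to finite measures serves the weighted
  laws below.\<close>

lemma Levy_uniqueness_finite:
  fixes M1 M2 :: "real measure"
  assumes M1: "finite_borel_measure M1" and M2: "finite_borel_measure M2"
    and eq: "\<And>t. (CLINT x|M1. iexp (t * x)) = (CLINT x|M2. iexp (t * x))"
  shows "M1 = M2"
proof -
  interpret M1: finite_borel_measure M1 by fact
  interpret M2: finite_borel_measure M2 by fact
  have sp[simp]: "space M1 = UNIV" "space M2 = UNIV"
    using sets_eq_imp_space_eq[OF M1.M_is_borel] sets_eq_imp_space_eq[OF M2.M_is_borel] by auto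
  note st[simp, measurable_cong] = M1.M_is_borel M2.M_is_borel
  define m where "m = measure M1 UNIV"
  have m2: "measure M2 UNIV = m"
    using eq[of 0] by (simp add: m_def)
  have e1: "emeasure M1 UNIV = ennreal m" and e2: "emeasure M2 UNIV = ennreal m"
    by (auto simp: m_def M1.emeasure_eq_measure M2.emeasure_eq_measure m2[unfolded m_def])
  show ?thesis
  proof (cases "m = 0")
    case True
    have "emeasure M1 A \<le> 0" "emeasure M2 A \<le> 0" for A
      using emeasure_space[of M1 A] emeasure_space[of M2 A] e1 e2 True by auto
    then show ?thesis by (intro measure_eqI) auto
  next
    case False
    then have m: "m > 0" by (simp add: m_def less_le)
    let ?D = "\<lambda>M::real measure. density M (\<lambda>_. ennreal (1 / m))"
    have i: "ennreal (1 / m) * ennreal m = 1"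
      using m by (simp flip: ennreal_mult)
    have "prob_space (?D M1)" "prob_space (?D M2)"
      by (auto intro!: prob_spaceI simp: emeasure_density_const e1 e2 i)
    then have r: "real_distribution (?D M1)" "real_distribution (?D M2)"
      by (auto intro!: real_distribution.intro simp: real_distribution_axioms_def)
    have "char (?D M1) = char (?D M2)"
    proof
      fix t
      have "char (?D M) t = (1 / m) *\<^sub>R (CLINT x|M. iexp (t * x))" if "sets M = sets borel" for M
        unfolding char_def using m that
        by (subst integral_density) (auto simp: measurable_cong_sets[OF that refl])
      then show "char (?D M1) t = char (?D M2) t" using eq[of t] by simp
    qed
    then have D: "?D M1 = ?D M2" using r by (intro Levy_uniqueness) auto
    show ?thesis
    proof (rule measure_eqI)
      fix A assume "A \<in> sets M1"
      then have "ennreal (1 / m) * emeasure M1 A = ennreal (1 / m) * emeasure M2 A"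
        using arg_cong[OF D, of "\<lambda>M. emeasure M A"] by (simp add: emeasure_density_const)
      then have "ennreal m * (ennreal (1 / m) * emeasure M1 A) =
                 ennreal m * (ennreal (1 / m) * emeasure M2 A)" by simp
      then show "emeasure M1 A = emeasure M2 A"
        using i by (simp add: mult.assoc[symmetric] mult.commute[of "ennreal m"])
    qed simp
  qed
qed

text \<open>The weight \<open>g\<close> becomes a density, which is why it must be nonnegative; its
  bound keeps the mass finite. The image under \<open>p\<close> of the weighted measure is then a
  finite measure on the line whose transform is the integral in \<open>eq\<close>.\<close>

lemma weighted_char_uniqueness:
  fixes p g :: "'b \<Rightarrow> real"
  assumes "finite_measure \<mu>" "finite_measure \<nu>" and st: "sets \<nu> = sets \<mu>"
    and p: "p \<in> borel_measurable \<mu>" and g: "g \<in> borel_measurable \<mu>"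
    and b: "\<And>z. 0 \<le> g z" "\<And>z. g z \<le> B"
    and eq: "\<And>t. (CLINT z|\<mu>. iexp (t * p z) * g z) = (CLINT z|\<nu>. iexp (t * p z) * g z)"
    and A: "A \<in> sets borel"
  shows "(LINT z|\<mu>. indicator A (p z) * g z) = (LINT z|\<nu>. indicator A (p z) * g z)"
proof -
  note [measurable] = p g A
  note [measurable_cong] = st
  let ?W = "\<lambda>M. distr (density M (\<lambda>z. ennreal (g z))) borel p"
  have W: "finite_borel_measure (?W M) \<and> (CLINT x|?W M. iexp (t * x)) = (CLINT z|M. iexp (t * p z) * g z)
      \<and> measure (?W M) A = (LINT z|M. indicator A (p z) * g z)"
    if "finite_measure M" and [measurable_cong]: "sets M = sets \<mu>" for M t
  proof (intro conjI)
    interpret M: finite_measure M by fact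
    have ig: "integrable M g" by (rule M.integrable_const_bound[where B=B]) (use b in auto)
    have "emeasure (density M (\<lambda>z. ennreal (g z))) (space M) = ennreal (LINT z|M. g z)"
      using ig b by (subst emeasure_density) (auto simp: nn_integral_eq_integral indicator_def
          cong: nn_integral_cong_simp)
    then have "finite_measure (density M (\<lambda>z. ennreal (g z)))"
      by (intro finite_measureI) auto
    then show "finite_borel_measure (?W M)"
      by (auto intro!: finite_borel_measure.intro finite_measure.finite_measure_distr
          simp: finite_borel_measure_axioms_def)
    show "(CLINT x|?W M. iexp (t * x)) = (CLINT z|M. iexp (t * p z) * g z)"
      by (subst integral_distr, simp, simp, subst integral_density)
         (auto simp: b scaleR_conv_of_real mult.commute)
    have "measure (?W M) A = (LINT x|?W M. indicator A x)" by simp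
    also have "\<dots> = (LINT z|M. indicator A (p z) * g z)"
      by (subst integral_distr, simp, simp, subst integral_density) (auto simp: b mult.commute)
    finally show "measure (?W M) A = (LINT z|M. indicator A (p z) * g z)" .
  qed
  have "?W \<mu> = ?W \<nu>"
    using W[of \<mu>] W[of \<nu>] assms by (intro Levy_uniqueness_finite) auto
  then show ?thesis using W[of \<mu>] W[of \<nu>] assms by auto
qed

text \<open>The laws of the linear combinations determine the joint characteristic function. From it
  the measures of all rectangles are recovered, one coordinate at a time.\<close>

lemma Cramer_Wold_pair:
  fixes \<mu> \<nu> :: "(real \<times> real) measure"
  assumes "prob_space \<mu>" "prob_space \<nu>"
    and s1: "sets \<mu> = sets (borel \<Otimes>\<^sub>M borel)" and s2: "sets \<nu> = sets (borel \<Otimes>\<^sub>M borel)"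
    and eq: "\<And>u v. distr \<mu> borel (\<lambda>(x, y). u * x + v * y) = distr \<nu> borel (\<lambda>(x, y). u * x + v * y)"
  shows "\<mu> = \<nu>"
proof -
  interpret m: prob_space \<mu> by fact
  interpret n: prob_space \<nu> by fact
  note [measurable_cong] = s1 s2
  have f: "finite_measure \<mu>" "finite_measure \<nu>" "sets \<nu> = sets \<mu>"
    using s1 s2 by (auto intro: m.finite_measure n.finite_measure)
  have bm: "integrable M h" if "finite_measure M" "sets M = sets (borel \<Otimes>\<^sub>M borel)"
    "h \<in> borel_measurable (borel \<Otimes>\<^sub>M borel)" "\<And>z. norm (h z) \<le> 3"
    for M :: "(real \<times> real) measure" and h :: "real \<times> real \<Rightarrow> 'c::{banach,second_countable_topology}"
    using that by (intro finite_measure.integrable_const_bound[where B=3])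
      (auto simp: measurable_cong_sets[OF that(2) refl])
  \<comment> \<open>The joint characteristic function at \<open>(t, u)\<close> is the
    one-dimensional one of \<open>t * x + u * y\<close> at 1.\<close>
  have J: "(CLINT z|\<mu>. iexp (t * fst z + u * snd z)) = (CLINT z|\<nu>. iexp (t * fst z + u * snd z))" for t u
  proof -
    have "(CLINT z|M. iexp (t * fst z + u * snd z)) =
        (CLINT x|distr M borel (\<lambda>(x, y). t * x + u * y). iexp x)"
      if [measurable_cong]: "sets M = sets (borel \<Otimes>\<^sub>M borel)" for M :: "(real \<times> real) measure"
      by (subst integral_distr) (auto simp: split_beta)
    then show ?thesis using eq[of t u] s1 s2 by simp
  qed
  have c: "(of_real (cos x) :: complex) = (iexp x + iexp (- x)) / 2" for x :: real
    by (auto simp: complex_eq_iff Re_exp Im_exp)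
  have s: "(of_real (sin x) :: complex) = (iexp x - iexp (- x)) / (2 * \<i>)" for x :: real
    by (auto simp: complex_eq_iff Re_exp Im_exp Re_divide Im_divide)
  \<comment> \<open>Each weighted transform is a combination of joint characteristic functions at
    \<open>(t, 0)\<close>, \<open>(t, u)\<close> and \<open>(t, - u)\<close>, so \<open>J\<close>
    makes it the same for both measures.\<close>
  have expand: "(CLINT z|M. iexp (t * fst z) * of_real (1 + cos (u * snd z))) =
        (CLINT z|M. iexp (t * fst z + 0 * snd z)) + (CLINT z|M. iexp (t * fst z + u * snd z)) / 2
        + (CLINT z|M. iexp (t * fst z + (-u) * snd z)) / 2"
      "(CLINT z|M. iexp (t * fst z) * of_real (1 + sin (u * snd z))) =
        (CLINT z|M. iexp (t * fst z + 0 * snd z)) + (CLINT z|M. iexp (t * fst z + u * snd z)) / (2 * \<i>)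
        - (CLINT z|M. iexp (t * fst z + (-u) * snd z)) / (2 * \<i>)"
    if M: "finite_measure M" "sets M = sets (borel \<Otimes>\<^sub>M borel)" for M :: "(real \<times> real) measure" and t u
  proof -
    define e where "e = (\<lambda>u (z :: real \<times> real). iexp (t * fst z + u * snd z))"
    have i: "integrable M (e u)" for u
      unfolding e_def by (rule bm[OF M]) auto
    have c': "iexp (t * fst z) * of_real (1 + cos (u * snd z)) = e 0 z + e u z / 2 + e (-u) z / 2"
      and s': "iexp (t * fst z) * of_real (1 + sin (u * snd z)) = e 0 z + e u z / (2 * \<i>) - e (- u) z / (2 * \<i>)"
      for z
      unfolding e_def of_real_add c s
      by (simp_all add: exp_add exp_minus exp_diff field_simps)
    have "(CLINT z|M. e 0 z + e u z / 2 + e (-u) z / 2) =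
        (CLINT z|M. e 0 z) + (CLINT z|M. e u z) / 2 + (CLINT z|M. e (-u) z) / 2"
      "(CLINT z|M. e 0 z + e u z / (2 * \<i>) - e (-u) z / (2 * \<i>)) =
        (CLINT z|M. e 0 z) + (CLINT z|M. e u z) / (2 * \<i>) - (CLINT z|M. e (-u) z) / (2 * \<i>)"
      using i by simp_all
    then show "(CLINT z|M. iexp (t * fst z) * of_real (1 + cos (u * snd z))) =
        (CLINT z|M. iexp (t * fst z + 0 * snd z)) + (CLINT z|M. iexp (t * fst z + u * snd z)) / 2
        + (CLINT z|M. iexp (t * fst z + (-u) * snd z)) / 2"
      "(CLINT z|M. iexp (t * fst z) * of_real (1 + sin (u * snd z))) =
        (CLINT z|M. iexp (t * fst z + 0 * snd z)) + (CLINT z|M. iexp (t * fst z + u * snd z)) / (2 * \<i>)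
        - (CLINT z|M. iexp (t * fst z + (-u) * snd z)) / (2 * \<i>)"
      unfolding c' s' by (simp_all only: e_def)
  qed
  \<comment> \<open>One-dimensional uniqueness is applied twice: to the first coordinate with the nonnegative
    weights \<open>1 + cos\<close> and \<open>1 + sin\<close> of the second, then to the second with weight \<open>1\<^sub>A\<close>.\<close>
  have main: "measure \<mu> (A \<times> B) = measure \<nu> (A \<times> B)" if A: "A \<in> sets borel" and B: "B \<in> sets borel" for A B
  proof -
    note [measurable] = A B
    let ?I = "\<lambda>M g. LINT z|M. indicator A (fst z) * (g (snd z) :: real)"
    have m: "fst \<in> borel_measurable \<mu>" "snd \<in> borel_measurable \<mu>" by auto
    have 1: "?I \<mu> (\<lambda>y. 1 + cos (u * y)) = ?I \<nu> (\<lambda>y. 1 + cos (u * y))" for u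
    proof (rule weighted_char_uniqueness[OF f m(1) _ _ _ _ A, where B=2])
      show "0 \<le> 1 + cos (u * snd z)" for z :: "real \<times> real" using cos_ge_minus_one[of "u * snd z"] by linarith
    qed (auto simp only: expand[OF f(1) s1] expand[OF f(2) s2] J, auto)
    have 2: "?I \<mu> (\<lambda>y. 1 + sin (u * y)) = ?I \<nu> (\<lambda>y. 1 + sin (u * y))" for u
    proof (rule weighted_char_uniqueness[OF f m(1) _ _ _ _ A, where B=2])
      show "0 \<le> 1 + sin (u * snd z)" for z :: "real \<times> real" using sin_ge_minus_one[of "u * snd z"] by linarith
    qed (auto simp only: expand[OF f(1) s1] expand[OF f(2) s2] J, auto)
    \<comment> \<open>At \<open>u = 0\<close> the weight \<open>1 + sin\<close> is the constant 1.
      Subtracting this case from \<open>1\<close> and \<open>2\<close> leaves the pure cosine and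
      sine weights.\<close>
    have 3: "?I \<mu> (\<lambda>y. 1) = ?I \<nu> (\<lambda>y. 1)"
      using 2[of 0] by simp
    have iA: "integrable M (\<lambda>z. indicator A (fst z) :: real)"
      "integrable M (\<lambda>z. indicator A (fst z) * cos (u * snd z) :: real)"
      "integrable M (\<lambda>z. indicator A (fst z) * sin (u * snd z) :: real)"
      if M: "finite_measure M" "sets M = sets (borel \<Otimes>\<^sub>M borel)" for M :: "(real \<times> real) measure" and u
      by (rule bm[OF M]; auto simp: indicator_def intro: order_trans[OF abs_cos_le_one] order_trans[OF abs_sin_le_one])+
    have 4: "?I \<mu> (\<lambda>y. cos (u * y)) = ?I \<nu> (\<lambda>y. cos (u * y))" for u
      using 1[of u] 3 by (simp add: distrib_left iA[OF f(1) s1] iA[OF f(2) s2])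
    have 5: "?I \<mu> (\<lambda>y. sin (u * y)) = ?I \<nu> (\<lambda>y. sin (u * y))" for u
      using 2[of u] 3 by (simp add: distrib_left iA[OF f(1) s1] iA[OF f(2) s2])
    \<comment> \<open>Cosine and sine recombine into the transform in the second coordinate with
      weight the indicator of \<open>A\<close>, ready for the second use of one-dimensional
      uniqueness.\<close>
    have ex: "(CLINT z|M. iexp (u * snd z) * of_real (indicator A (fst z))) =
      of_real (?I M (\<lambda>y. cos (u * y))) + \<i> * of_real (?I M (\<lambda>y. sin (u * y)))"
      if M: "finite_measure M" "sets M = sets (borel \<Otimes>\<^sub>M borel)" for M :: "(real \<times> real) measure" and u
    proof -
      have "iexp (u * snd z) * of_real (indicator A (fst z)) =
        of_real (indicator A (fst z) * cos (u * snd z)) + \<i> * of_real (indicator A (fst z) * sin (u * snd z))"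
        for z :: "real \<times> real"
        by (auto simp: complex_eq_iff Re_exp Im_exp)
      then show ?thesis
        by (simp only:) (subst Bochner_Integration.integral_add,
            auto simp del: of_real_mult simp: iA[OF M])
    qed
    have "(LINT z|\<mu>. indicator B (snd z) * indicator A (fst z)) =
      (LINT z|\<nu>. indicator B (snd z) * indicator A (fst z) :: real)"
      by (rule weighted_char_uniqueness[OF f m(2) _ _ _ _ B, where B=1])
        (use A B in \<open>auto simp only: ex[OF f(1) s1] ex[OF f(2) s2] 4 5\<close>, auto)
    moreover have "indicator B (snd z) * indicator A (fst z) = (indicator (A \<times> B) z :: real)" for z
      by (auto simp: indicator_def mem_Times_iff)
    moreover have "A \<times> B \<in> sets \<mu>" "A \<times> B \<in> sets \<nu>" using A B s1 s2 by auto
    ultimately show ?thesis by simp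
  qed
  show ?thesis
  proof (rule measure_eqI_generator_eq[OF Int_stable_pair_measure_generator[of borel borel], where A="\<lambda>_. UNIV"])
    show "emeasure \<mu> X = emeasure \<nu> X" if "X \<in> {a \<times> b |a b. a \<in> sets borel \<and> b \<in> sets borel}" for X
      using that main by (auto simp: m.emeasure_eq_measure n.emeasure_eq_measure)
    show "sets \<mu> = sigma_sets UNIV {a \<times> b |a b. a \<in> sets borel \<and> b \<in> sets borel}"
      "sets \<nu> = sigma_sets UNIV {a \<times> b |a b. a \<in> sets borel \<and> b \<in> sets borel}"
      by (simp_all add: s1 s2 sets_pair_measure)
    show "range (\<lambda>_. UNIV) \<subseteq> {a \<times> b |a b. a \<in> sets (borel::real measure) \<and> b \<in> sets (borel::real measure)}"
      using UNIV_Times_UNIV[where 'a=real and 'b=real] by (auto simp: image_subset_iff) (metis UNIV_Times_UNIV sets.top space_borel)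
  qed auto
qed

section \<open>Characterization and symmetries of the bivariate normal law\<close>

lemma prob_space_bivariate_std_normal: "prob_space (bivariate_std_normal \<rho>)"
proof -
  interpret G: prob_space std_normal_distribution by (rule prob_space_std_normal)
  interpret P: pair_prob_space std_normal_distribution std_normal_distribution ..
  show ?thesis
    unfolding bivariate_std_normal_def by (rule P.prob_space_distr) simp
qed

lemma sets_bivariate_std_normal [measurable_cong, simp]:
  "sets (bivariate_std_normal \<rho>) = sets (borel \<Otimes>\<^sub>M borel)"
  by (simp add: bivariate_std_normal_def)

lemma space_bivariate_std_normal [simp]: "space (bivariate_std_normal \<rho>) = UNIV"
  by (simp add: bivariate_std_normal_def space_pair_measure)

text \<open>In the defining representation the two independent normals get coefficients
  \<open>u + v * \<rho>\<close> and \<open>v * sqrt (1 - \<rho>\<^sup>2)\<close>. Their squares add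
  up to the stated variance, because \<open>\<bar>\<rho>\<bar> \<le> 1\<close> makes the square root
  genuine.\<close>

lemma bivariate_std_normal_combination:
  assumes "\<bar>\<rho>\<bar> \<le> 1"
  shows "distr (bivariate_std_normal \<rho>) borel (\<lambda>(x, y). u * x + v * y) =
    normal_law 0 (sqrt (u\<^sup>2 + v\<^sup>2 + 2 * \<rho> * u * v))"
proof -
  have "distr (bivariate_std_normal \<rho>) borel (\<lambda>(x, y). u * x + v * y) =
      distr (std_normal_distribution \<Otimes>\<^sub>M std_normal_distribution) borel
        (\<lambda>(x, y). (u + v * \<rho>) * x + (v * sqrt (1 - \<rho>\<^sup>2)) * y)"
    unfolding bivariate_std_normal_def
    by (subst distr_distr) (auto intro!: distr_cong simp: algebra_simps)
  moreover have "\<rho>\<^sup>2 \<le> 1" using assms by (simp add: abs_square_le_1)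
  ultimately show ?thesis
    unfolding std_normal_pair_combination
    by (simp add: power_mult_distrib) (simp add: power2_eq_square algebra_simps)
qed

lemma bivariate_std_normal_unique:
  assumes "\<bar>\<rho>\<bar> \<le> 1" "prob_space \<mu>" "sets \<mu> = sets (borel \<Otimes>\<^sub>M borel)"
    and "\<And>u v. distr \<mu> borel (\<lambda>(x, y). u * x + v * y) = normal_law 0 (sqrt (u\<^sup>2 + v\<^sup>2 + 2 * \<rho> * u * v))"
  shows "\<mu> = bivariate_std_normal \<rho>"
  using assms by (intro Cramer_Wold_pair)
    (auto simp: bivariate_std_normal_combination prob_space_bivariate_std_normal)

text \<open>The assumptions \<open>q\<close> say that the image coordinates have unit variances and
  covariance \<open>\<rho>'\<close>. The variance of every linear combination of the image then has
  the form required for uniqueness.\<close>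

lemma bivariate_std_normal_linear_image:
  assumes \<rho>: "\<bar>\<rho>\<bar> \<le> 1" and \<rho>': "\<bar>\<rho>'\<bar> \<le> 1"
    and f: "f = (\<lambda>(x, y). (a * x + b * y, d * x + e * y))"
    and q: "a\<^sup>2 + b\<^sup>2 + 2 * \<rho> * a * b = 1" "d\<^sup>2 + e\<^sup>2 + 2 * \<rho> * d * e = 1"
      "a * d + b * e + \<rho> * (a * e + b * d) = \<rho>'"
  shows "distr (bivariate_std_normal \<rho>) (borel \<Otimes>\<^sub>M borel) f = bivariate_std_normal \<rho>'"
proof (rule bivariate_std_normal_unique[OF \<rho>'])
  interpret prob_space "bivariate_std_normal \<rho>" by (rule prob_space_bivariate_std_normal)
  show "prob_space (distr (bivariate_std_normal \<rho>) (borel \<Otimes>\<^sub>M borel) f)"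
    unfolding f by (rule prob_space_distr) simp
  fix u v
  have "distr (distr (bivariate_std_normal \<rho>) (borel \<Otimes>\<^sub>M borel) f) borel (\<lambda>(x, y). u * x + v * y) =
      distr (bivariate_std_normal \<rho>) borel (\<lambda>(x, y). (u * a + v * d) * x + (u * b + v * e) * y)"
    unfolding f by (subst distr_distr) (auto intro!: distr_cong simp: algebra_simps)
  also have "\<dots> = normal_law 0 (sqrt ((u * a + v * d)\<^sup>2 + (u * b + v * e)\<^sup>2
      + 2 * \<rho> * (u * a + v * d) * (u * b + v * e)))"
    by (rule bivariate_std_normal_combination[OF \<rho>])
  also have "(u * a + v * d)\<^sup>2 + (u * b + v * e)\<^sup>2 + 2 * \<rho> * (u * a + v * d) * (u * b + v * e) =
      u\<^sup>2 * (a\<^sup>2 + b\<^sup>2 + 2 * \<rho> * a * b) + v\<^sup>2 * (d\<^sup>2 + e\<^sup>2 + 2 * \<rho> * d * e)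
      + 2 * (a * d + b * e + \<rho> * (a * e + b * d)) * u * v"
    by (simp add: power2_eq_square algebra_simps)
  finally show "distr (distr (bivariate_std_normal \<rho>) (borel \<Otimes>\<^sub>M borel) f) borel (\<lambda>(x, y). u * x + v * y) =
      normal_law 0 (sqrt (u\<^sup>2 + v\<^sup>2 + 2 * \<rho>' * u * v))"
    by (simp add: q)
qed simp

text \<open>The coefficient matrices are the coordinate exchange, minus the identity, and the
  reflection of the second axis; only the last one changes the correlation.\<close>

lemma
  assumes "\<bar>\<rho>\<bar> \<le> 1"
  shows bivariate_std_normal_swap:
      "distr (bivariate_std_normal \<rho>) (borel \<Otimes>\<^sub>M borel) (\<lambda>(x, y). (y, x)) = bivariate_std_normal \<rho>"
    and bivariate_std_normal_uminus:
      "distr (bivariate_std_normal \<rho>) (borel \<Otimes>\<^sub>M borel) (\<lambda>(x, y). (- x, - y)) = bivariate_std_normal \<rho>"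
    and bivariate_std_normal_uminus_snd:
      "distr (bivariate_std_normal \<rho>) (borel \<Otimes>\<^sub>M borel) (\<lambda>(x, y). (x, - y)) = bivariate_std_normal (- \<rho>)"
  using bivariate_std_normal_linear_image[OF assms assms, of _ 0 1 1 0]
    bivariate_std_normal_linear_image[OF assms assms, of _ "-1" 0 0 "-1"]
    bivariate_std_normal_linear_image[OF assms, of "- \<rho>" _ 1 0 0 "-1"] assms
  by auto

subsection \<open>Ornstein-Uhlenbeck operators\<close>

text \<open>This is Mehler's formula for the Ornstein-Uhlenbeck semigroup, with \<open>r\<close> in
  the place of exp(-t). For \<open>\<bar>r\<bar> \<le> 1\<close> it is the conditional expectation
  of f(Y) given X = x when (X, Y) has law \<open>bivariate_std_normal r\<close>.\<close>

definition noise_op :: "real \<Rightarrow> (real \<Rightarrow> real) \<Rightarrow> real \<Rightarrow> real" where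
  "noise_op r f x = (LINT z|std_normal_distribution. f (r * x + sqrt (1 - r\<^sup>2) * z))"

lemma noise_op_measurable [measurable]:
  assumes [measurable]: "f \<in> borel_measurable borel"
  shows "noise_op r f \<in> borel_measurable borel"
proof -
  interpret G: prob_space std_normal_distribution by (rule prob_space_std_normal)
  show ?thesis
    unfolding noise_op_def by measurable
qed

lemma integrable_std_normal_bounded:
  fixes f :: "real \<Rightarrow> real"
  assumes "f \<in> borel_measurable borel" "\<And>x. \<bar>f x\<bar> \<le> b"
  shows "integrable std_normal_distribution f"
proof -
  interpret G: prob_space std_normal_distribution by (rule prob_space_std_normal)
  show ?thesis using assms by (intro G.integrable_const_bound[where B=b]) auto
qed

lemma noise_op_bounded:
  assumes f: "f \<in> borel_measurable borel" "\<And>x. \<bar>f x\<bar> \<le> b"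
  shows "\<bar>noise_op r f x\<bar> \<le> b"
proof -
  interpret G: prob_space std_normal_distribution by (rule prob_space_std_normal)
  have [measurable]: "f \<in> borel_measurable borel" by fact
  have "0 \<le> b" using f(2)[of 0] by linarith
  have "\<bar>noise_op r f x\<bar> \<le> (LINT z|std_normal_distribution. \<bar>f (r * x + sqrt (1 - r\<^sup>2) * z)\<bar>)"
    unfolding noise_op_def by (rule integral_abs_bound)
  also have "\<dots> \<le> (LINT z|std_normal_distribution. b)"
    by (intro integral_mono integrable_std_normal_bounded[where b=b]) (use f \<open>0 \<le> b\<close> in auto)
  finally show ?thesis using G.prob_space by simp
qed

text \<open>Fubini in the defining representation: integrating out the second independent normal
  first turns \<open>g\<close> into \<open>noise_op r g\<close>. The bounds supply
  integrability.\<close>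

lemma integral_bivariate_std_normal:
  assumes f: "f \<in> borel_measurable borel" "\<And>x. \<bar>f x\<bar> \<le> b"
    and g: "g \<in> borel_measurable borel" "\<And>x. \<bar>g x\<bar> \<le> b'"
  shows "(LINT (x, y)|bivariate_std_normal r. f x * g y) =
    (LINT x|std_normal_distribution. f x * noise_op r g x)"
proof -
  let ?G = std_normal_distribution
  interpret G: prob_space ?G by (rule prob_space_std_normal)
  interpret P: pair_prob_space ?G ?G ..
  note [measurable] = f(1) g(1)
  have b: "0 \<le> b" "0 \<le> b'" using order_trans[OF abs_ge_zero f(2)] order_trans[OF abs_ge_zero g(2)] by auto
  have "(LINT (x, y)|bivariate_std_normal r. f x * g y) =
      (LINT (x, z)|(?G \<Otimes>\<^sub>M ?G). f x * g (r * x + sqrt (1 - r\<^sup>2) * z))"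
    unfolding bivariate_std_normal_def by (subst integral_distr) (auto simp: case_prod_unfold)
  also have "\<dots> = (LINT x|?G. LINT z|?G. f x * g (r * x + sqrt (1 - r\<^sup>2) * z))"
    by (subst P.integral_fst'[symmetric])
      (auto intro!: P.integrable_const_bound[where B="b * b'"] AE_I2 mult_mono simp: case_prod_unfold abs_mult f g b)
  finally show ?thesis by (simp add: noise_op_def)
qed

text \<open>The two averages add independent centered normals of variances
  \<open>b\<^sup>2 * (1 - a\<^sup>2)\<close> and \<open>1 - b\<^sup>2\<close>. The sum is normal
  with variance \<open>1 - (a * b)\<^sup>2\<close>, exactly the noise in
  \<open>noise_op (a * b)\<close>.\<close>

lemma noise_op_comp:
  assumes a: "\<bar>a\<bar> \<le> 1" and b: "\<bar>b\<bar> \<le> 1"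
    and f: "f \<in> borel_measurable borel" "\<And>x. \<bar>f x\<bar> \<le> B"
  shows "noise_op a (noise_op b f) x = noise_op (a * b) f x"
proof -
  let ?G = std_normal_distribution
  interpret G: prob_space ?G by (rule prob_space_std_normal)
  interpret P: pair_prob_space ?G ?G ..
  note [measurable] = f(1)
  let ?u = "b * sqrt (1 - a\<^sup>2)" and ?v = "sqrt (1 - b\<^sup>2)"
  have ab: "a\<^sup>2 \<le> 1" "b\<^sup>2 \<le> 1" using a b by (simp_all add: abs_square_le_1)
  have "\<bar>a * b\<bar> \<le> 1" using a b by (simp add: abs_mult mult_le_one)
  then have abm: "(a * b)\<^sup>2 \<le> 1" by (simp add: abs_square_le_1)
  have "noise_op a (noise_op b f) x = (LINT z|?G. LINT z'|?G. f (a * b * x + (?u * z + ?v * z')))"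
    unfolding noise_op_def by (simp add: algebra_simps)
  also have "\<dots> = (LINT (z, z')|(?G \<Otimes>\<^sub>M ?G). f (a * b * x + (?u * z + ?v * z')))"
    by (subst P.integral_fst'[symmetric])
      (auto intro!: P.integrable_const_bound[where B=B] simp: case_prod_unfold f)
  also have "\<dots> = (LINT y|distr (?G \<Otimes>\<^sub>M ?G) borel (\<lambda>(z, z'). ?u * z + ?v * z'). f (a * b * x + y))"
    by (subst integral_distr) (auto simp: case_prod_unfold)
  also have "\<dots> = (LINT y|normal_law 0 (sqrt (1 - (a * b)\<^sup>2)). f (a * b * x + y))"
  proof -
    have "?u\<^sup>2 + ?v\<^sup>2 = 1 - (a * b)\<^sup>2"
      using ab by (simp add: power_mult_distrib) (simp add: algebra_simps)
    then show ?thesis unfolding std_normal_pair_combination by simp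
  qed
  also have "\<dots> = noise_op (a * b) f x"
    using abm by (simp add: normal_law_0_eq_distr noise_op_def integral_distr)
  finally show ?thesis .
qed

text \<open>Both sides are the expectation of f(X) g(Y), up to exchanging the coordinates, and the
  bivariate law is exchangeable.\<close>

lemma noise_op_symmetric:
  assumes "\<bar>r\<bar> \<le> 1"
    and f: "f \<in> borel_measurable borel" "\<And>x. \<bar>f x\<bar> \<le> b"
    and g: "g \<in> borel_measurable borel" "\<And>x. \<bar>g x\<bar> \<le> b'"
  shows "(LINT x|std_normal_distribution. f x * noise_op r g x) =
    (LINT x|std_normal_distribution. noise_op r f x * g x)"
proof -
  note [measurable] = f(1) g(1)
  have "(LINT (x, y)|bivariate_std_normal r. f x * g y) = (LINT (x, y)|bivariate_std_normal r. g x * f y)"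
    by (subst bivariate_std_normal_swap[OF assms(1), symmetric], subst integral_distr)
      (auto simp: case_prod_unfold mult.commute)
  then show ?thesis
    unfolding integral_bivariate_std_normal[OF f g] integral_bivariate_std_normal[OF g f]
    by (simp add: mult.commute)
qed

text \<open>Jensen gives the pointwise bound \<open>J\<close>; integrating it loses nothing on the
  right, since the second margin of the bivariate law is again standard normal.\<close>

lemma noise_op_contraction:
  assumes "\<bar>r\<bar> \<le> 1" and f: "f \<in> borel_measurable borel" "\<And>x. \<bar>f x\<bar> \<le> b"
  shows "(LINT x|std_normal_distribution. (noise_op r f x)\<^sup>2) \<le> (LINT x|std_normal_distribution. (f x)\<^sup>2)"
proof -
  let ?G = std_normal_distribution
  interpret G: prob_space ?G by (rule prob_space_std_normal)
  note [measurable] = f(1)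
  have f2: "(\<lambda>x. (f x)\<^sup>2) \<in> borel_measurable borel" "\<And>x. \<bar>(f x)\<^sup>2\<bar> \<le> b\<^sup>2"
    using f by (auto simp: abs_le_square_iff[symmetric] intro: order_trans[OF _ abs_ge_self])
  have J: "(noise_op r f x)\<^sup>2 \<le> noise_op r (\<lambda>x. (f x)\<^sup>2) x" for x
  proof -
    let ?h = "\<lambda>z. f (r * x + sqrt (1 - r\<^sup>2) * z)"
    \<comment> \<open>Jensen for the square is nonnegativity of this variance.\<close>
    have "G.variance ?h = noise_op r (\<lambda>x. (f x)\<^sup>2) x - (noise_op r f x)\<^sup>2"
      unfolding noise_op_def
      by (intro G.variance_eq integrable_std_normal_bounded[where b="b"] integrable_std_normal_bounded[where b="b\<^sup>2"])
         (use f2 f in auto)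
    then show ?thesis using G.variance_positive[of ?h] by simp
  qed
  have "(LINT x|?G. (noise_op r f x)\<^sup>2) \<le> (LINT x|?G. noise_op r (\<lambda>x. (f x)\<^sup>2) x)"
  proof (intro integral_mono J integrable_std_normal_bounded[where b="b\<^sup>2"])
    show "\<bar>(noise_op r f x)\<^sup>2\<bar> \<le> b\<^sup>2" for x
      using noise_op_bounded[OF f, of r x] by (simp add: abs_le_square_iff[symmetric])
  qed (use f2 noise_op_bounded[OF f2] in auto)
  also have "\<dots> = (LINT (x, y)|bivariate_std_normal r. 1 * (f y)\<^sup>2)"
    using integral_bivariate_std_normal[OF _ _ f2, of "\<lambda>_. 1" 1 r] by simp
  also have "\<dots> = (LINT y|distr (bivariate_std_normal r) borel snd. (f y)\<^sup>2)"
    by (subst integral_distr) (auto simp: case_prod_unfold)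
  finally show ?thesis by (simp add: bivariate_std_normal_marginals[OF assms(1)])
qed

lemma bivariate_std_normal_mono:
  fixes f :: "real \<Rightarrow> real"
  assumes r: "0 \<le> \<rho>" "\<rho> \<le> \<rho>'" "\<rho>' \<le> 1"
    and f: "f \<in> borel_measurable borel" "\<And>x. \<bar>f x\<bar> \<le> b"
  shows "(LINT (x, y)|bivariate_std_normal \<rho>. f x * f y) \<le> (LINT (x, y)|bivariate_std_normal \<rho>'. f x * f y)"
proof -
  let ?G = std_normal_distribution
  note m = noise_op_measurable[OF f(1)] noise_op_bounded[OF f]
  \<comment> \<open>Write \<open>s\<close> as \<open>sqrt s * sqrt s\<close>, split the operator
    accordingly, and move one factor across by symmetry.\<close>
  have sq: "(LINT (x, y)|bivariate_std_normal s. f x * f y) = (LINT x|?G. (noise_op (sqrt s) f x)\<^sup>2)"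
    if "0 \<le> s" "s \<le> 1" for s
  proof -
    have "(LINT (x, y)|bivariate_std_normal s. f x * f y) = (LINT x|?G. f x * noise_op s f x)"
      by (rule integral_bivariate_std_normal[OF f f])
    also have "\<dots> = (LINT x|?G. f x * noise_op (sqrt s) (noise_op (sqrt s) f) x)"
      using that by (subst noise_op_comp[OF _ _ f]) auto
    also have "\<dots> = (LINT x|?G. (noise_op (sqrt s) f x)\<^sup>2)"
      using that by (subst noise_op_symmetric[OF _ f m]) (auto simp: power2_eq_square)
    finally show ?thesis .
  qed
  show ?thesis
  proof (cases "\<rho>' = 0")
    case False
    \<comment> \<open>The ratio is chosen so that the operator at \<open>sqrt \<rho>\<close> is the
      one at \<open>a\<close> applied after the one at \<open>sqrt \<rho>'\<close>, and
      \<open>\<rho> \<le> \<rho>'\<close> makes it a contraction. The excluded case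
      \<open>\<rho>' = 0\<close> forces \<open>\<rho> = 0\<close>.\<close>
    define a where "a = sqrt (\<rho> / \<rho>')"
    have a: "sqrt \<rho> = a * sqrt \<rho>'" "\<bar>a\<bar> \<le> 1"
      using r False by (auto simp: a_def real_sqrt_divide)
    have "noise_op (sqrt \<rho>) f x = noise_op a (noise_op (sqrt \<rho>') f) x" for x
      using r a by (subst noise_op_comp[OF _ _ f]) auto
    then show ?thesis
      using noise_op_contraction[OF a(2) m] r by (simp add: sq)
  qed (use r in simp)
qed

subsection \<open>The covariance of two rejections\<close>

lemma std_normal_uminus: "distr std_normal_distribution borel uminus = std_normal_distribution"
proof -
  interpret prob_space std_normal_distribution by (rule prob_space_std_normal)
  have "distributed std_normal_distribution lborel (\<lambda>x. x) std_normal_density"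
    by (simp add: distributed_def distr_id2)
  from normal_density_affine[OF this, of "-1" 0]
  have "distr std_normal_distribution lborel uminus = std_normal_distribution"
    by (simp add: distributed_def)
  then show ?thesis by (simp cong: distr_cong)
qed

lemma std_normal_two_sided_tail:
  assumes "0 \<le> c"
  shows "measure std_normal_distribution {x. c < \<bar>x\<bar>} = 2 * (1 - Phi c)"
proof -
  let ?G = std_normal_distribution
  interpret G: prob_space ?G by (rule prob_space_std_normal)
  have "measure ?G {x. x < - c} = measure (distr ?G borel uminus) {x. c < x}"
    by (subst measure_distr) (auto intro!: arg_cong[where f="measure ?G"])
  then have "measure ?G {x. x < - c} = measure ?G {x. c < x}"
    by (simp add: std_normal_uminus)
  moreover have "{x. c < x} = space ?G - {..c}" by auto
  then have "measure ?G {x. c < x} = 1 - Phi c"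
    by (simp add: Phi_def cdf_def G.prob_compl[of "{..c}", simplified])
  moreover have "{x. c < \<bar>x\<bar>} = {x. c < x} \<union> {x. x < - c}" by auto
  ultimately show ?thesis
    using assms by (simp add: G.finite_measure_Union[of "{x. c < x}" "{x. x < - c}"] disjoint_iff)
qed

text \<open>For negative \<open>c\<close> the half-lines up to \<open>c\<close> and from
  \<open>- c\<close> would be disjoint, and by symmetry each would have mass above 1/2.\<close>

lemma Phi_nonneg_quantile:
  assumes "1 / 2 < Phi c"
  shows "0 \<le> c"
proof (rule ccontr)
  assume c: "\<not> 0 \<le> c"
  let ?G = std_normal_distribution
  interpret G: prob_space ?G by (rule prob_space_std_normal)
  have "measure ?G {- c..} = measure (distr ?G borel uminus) {..c}"
    by (subst measure_distr) (auto intro!: arg_cong[where f="measure ?G"])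
  then have "measure ?G {- c..} = Phi c"
    by (simp add: std_normal_uminus Phi_def cdf_def)
  moreover have "measure ?G ({..c} \<union> {- c..}) = measure ?G {..c} + measure ?G {- c..}"
    using c by (intro G.finite_measure_Union) auto
  ultimately show False
    using assms G.prob_le_1[of "{..c} \<union> {- c..}"] by (simp add: Phi_def cdf_def)
qed

text \<open>Inclusion-exclusion on the complement, the union of the two half-planes where a
  coordinate is at most \<open>c\<close>.\<close>

lemma bivariate_upper_orthant:
  assumes "\<bar>\<rho>\<bar> \<le> 1"
  shows "measure (bivariate_std_normal \<rho>) {p. c < fst p \<and> c < snd p} = 1 - 2 * Phi c + Phi2 \<rho> c c"
proof -
  let ?B = "bivariate_std_normal \<rho>"
  interpret prob_space ?B by (rule prob_space_bivariate_std_normal)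
  let ?X = "{p::real \<times> real. fst p \<le> c}" and ?Y = "{p::real \<times> real. snd p \<le> c}"
  have "{p \<in> space ?B. fst p \<le> c} \<in> events" "{p \<in> space ?B. snd p \<le> c} \<in> events"
    by measurable
  then have ev [measurable]: "?X \<in> events" "?Y \<in> events" by simp_all
  have "prob ?X = measure (distr ?B borel fst) {..c}" "prob ?Y = measure (distr ?B borel snd) {..c}"
    by (subst measure_distr; auto intro!: arg_cong[where f=prob])+
  then have XY: "prob ?X = Phi c" "prob ?Y = Phi c"
    by (simp_all add: bivariate_std_normal_marginals[OF assms] Phi_def cdf_def)
  have "{p. c < fst p \<and> c < snd p} = space ?B - (?X \<union> ?Y)" by auto
  then have "prob {p. c < fst p \<and> c < snd p} = 1 - prob (?X \<union> ?Y)"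
    by (simp only:) (rule prob_compl, measurable)
  moreover have "prob (?X \<union> ?Y) = prob ?X + prob ?Y - prob (?X \<inter> ?Y)"
    by (rule measure_Un3) (use ev in \<open>simp_all add: fmeasurable_eq_sets\<close>)
  moreover have "?X \<inter> ?Y = {..c} \<times> {..c}" by auto
  ultimately show ?thesis
    by (simp add: XY Phi2_def)
qed

text \<open>The double rejection region splits into four quadrants, disjoint because
  \<open>0 \<le> c\<close>. The two equal-sign quadrants contribute \<open>Phi2 \<rho> c c\<close>,
  the two mixed ones \<open>Phi2 (- \<rho>) c c\<close>; subtracting
  \<open>4 * (1 - Phi c)\<^sup>2\<close> cancels the constant and linear terms in
  \<open>Phi c\<close>.\<close>

lemma R_term_eq_covariance:
  assumes \<rho>: "\<bar>\<rho>\<bar> \<le> 1" and c: "0 \<le> c"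
  shows "R_term \<rho> c = measure (bivariate_std_normal \<rho>) {p. c < \<bar>fst p\<bar> \<and> c < \<bar>snd p\<bar>}
    - (measure std_normal_distribution {x. c < \<bar>x\<bar>})\<^sup>2"
proof -
  let ?B = "bivariate_std_normal \<rho>"
  interpret prob_space ?B by (rule prob_space_bivariate_std_normal)
  let ?PP = "{p::real \<times> real. c < fst p \<and> c < snd p}" and ?PM = "{p::real \<times> real. c < fst p \<and> snd p < - c}"
  let ?MP = "{p::real \<times> real. fst p < - c \<and> c < snd p}" and ?MM = "{p::real \<times> real. fst p < - c \<and> snd p < - c}"
  have "{p \<in> space ?B. c < fst p \<and> c < snd p} \<in> events" "{p \<in> space ?B. c < fst p \<and> snd p < - c} \<in> events"
    "{p \<in> space ?B. fst p < - c \<and> c < snd p} \<in> events" "{p \<in> space ?B. fst p < - c \<and> snd p < - c} \<in> events"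
    by measurable
  then have ev: "?PP \<in> events" "?PM \<in> events" "?MP \<in> events" "?MM \<in> events" by simp_all
  have PP: "prob ?PP = 1 - 2 * Phi c + Phi2 \<rho> c c"
    by (rule bivariate_upper_orthant[OF \<rho>])
  have MM: "prob ?MM = prob ?PP"
    by (subst (2) bivariate_std_normal_uminus[OF \<rho>, symmetric], subst measure_distr)
       (use ev in \<open>auto intro!: arg_cong[where f=prob]\<close>)
  \<comment> \<open>Reflecting the second coordinate carries this mixed quadrant to the upper
    orthant under correlation \<open>- \<rho>\<close>.\<close>
  have PM: "prob ?PM = 1 - 2 * Phi c + Phi2 (- \<rho>) c c"
    by (subst bivariate_upper_orthant[symmetric], use \<rho> in simp,
        subst bivariate_std_normal_uminus_snd[OF \<rho>, symmetric], subst measure_distr)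
       (use ev in \<open>auto intro!: arg_cong[where f=prob]\<close>)
  have MP: "prob ?MP = prob ?PM"
    by (subst (2) bivariate_std_normal_uminus[OF \<rho>, symmetric], subst measure_distr)
       (use ev in \<open>auto intro!: arg_cong[where f=prob]\<close>)
  have "{p. c < \<bar>fst p\<bar> \<and> c < \<bar>snd p\<bar>} = (?PP \<union> ?PM) \<union> (?MP \<union> ?MM)" by auto
  moreover have "prob ((?PP \<union> ?PM) \<union> (?MP \<union> ?MM)) = prob (?PP \<union> ?PM) + prob (?MP \<union> ?MM)"
    using c ev by (intro finite_measure_Union) auto
  moreover have "prob (?PP \<union> ?PM) = prob ?PP + prob ?PM"
    using c ev by (intro finite_measure_Union) auto
  moreover have "prob (?MP \<union> ?MM) = prob ?MP + prob ?MM"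
    using c ev by (intro finite_measure_Union) auto
  ultimately show ?thesis
    unfolding R_term_def std_normal_two_sided_tail[OF c]
    by (simp only: PP MM PM MP) (simp add: power2_eq_square algebra_simps)
qed

section \<open>Dependence of \<open>R_term\<close> on the correlation\<close>

lemma R_term_uminus: "R_term (- \<rho>) c = R_term \<rho> c"
  by (simp add: R_term_def)

lemma R_term_0: "R_term 0 c = 0"
proof -
  let ?G = std_normal_distribution
  interpret G: prob_space ?G by (rule prob_space_std_normal)
  interpret P: pair_prob_space ?G ?G ..
  have "Phi2 0 c c = measure (?G \<Otimes>\<^sub>M ?G) ({..c} \<times> {..c})"
    unfolding Phi2_def bivariate_std_normal_def
    by (subst measure_distr) (auto intro!: arg_cong[where f="measure (?G \<Otimes>\<^sub>M ?G)"] simp: space_pair_measure)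
  also have "\<dots> = (Phi c)\<^sup>2"
    by (simp add: measure_def G.emeasure_pair_measure_Times enn2real_mult Phi_def cdf_def power2_eq_square)
  finally show ?thesis by (simp add: R_term_def)
qed

text \<open>With \<open>f\<close> the indicator of the two-sided tail, the joint tail probability is
  the expectation of f(X) f(Y), which is monotone for nonnegative correlations. Evenness allows
  replacing \<open>\<rho>\<close> by its absolute value.\<close>

lemma R_term_mono:
  assumes "\<bar>\<rho>\<bar> \<le> \<rho>'" "\<rho>' \<le> 1" and c: "0 \<le> c"
  shows "R_term \<rho> c \<le> R_term \<rho>' c"
proof -
  define f :: "real \<Rightarrow> real" where "f x = indicator {x. c < \<bar>x\<bar>} x" for x
  have [measurable]: "f \<in> borel_measurable borel" unfolding f_def by measurable
  have eq: "(LINT (x, y)|bivariate_std_normal r. f x * f y) =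
      measure (bivariate_std_normal r) {p. c < \<bar>fst p\<bar> \<and> c < \<bar>snd p\<bar>}" for r
  proof -
    have "f (fst p) * f (snd p) = indicator {p. c < \<bar>fst p\<bar> \<and> c < \<bar>snd p\<bar>} p" for p
      by (auto simp: f_def indicator_def)
    then show ?thesis by (simp add: case_prod_unfold)
  qed
  have "(LINT (x, y)|bivariate_std_normal \<bar>\<rho>\<bar>. f x * f y) \<le> (LINT (x, y)|bivariate_std_normal \<rho>'. f x * f y)"
    using assms by (intro bivariate_std_normal_mono[where b=1]) (auto simp: f_def indicator_def)
  then have "R_term \<bar>\<rho>\<bar> c \<le> R_term \<rho>' c"
    using assms by (simp add: eq R_term_eq_covariance[OF _ c])
  then show ?thesis
    by (cases "0 \<le> \<rho>") (auto simp: R_term_uminus)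
qed

lemma R_term_nonneg:
  assumes "0 \<le> \<rho>" "\<rho> \<le> 1" "0 \<le> c"
  shows "0 \<le> R_term \<rho> c"
  using R_term_mono[of 0 \<rho> c] assms by (simp add: R_term_0)

section \<open>Pairs of coordinates in a jointly normal family\<close>

lemma integral_normal_law:
  assumes "0 \<le> \<sigma>"
  shows "(LINT x|normal_law \<mu> \<sigma>. x) = \<mu>" "(LINT x|normal_law \<mu> \<sigma>. (x - \<mu>)\<^sup>2) = \<sigma>\<^sup>2"
proof -
  show "(LINT x|normal_law \<mu> \<sigma>. x) = \<mu>"
    using assms by (auto simp: normal_law_def integral_return integral_density integral_normal_moment_nz_1)
  show "(LINT x|normal_law \<mu> \<sigma>. (x - \<mu>)\<^sup>2) = \<sigma>\<^sup>2"
    using assms integral_normal_moment_even[of \<sigma> \<mu> 1]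
    by (auto simp: normal_law_def integral_return integral_density numeral_2_eq_2)
qed

text \<open>Joint normality only asserts that each combination has some mean and deviation.
  Computing the first two moments identifies them as 0 and the root of
  \<open>u\<^sup>2 + v\<^sup>2 + 2 * r * u * v\<close>, which characterizes the bivariate law,
  singular cases included.\<close>

lemma jointly_normal_pair:
  assumes "prob_space P" "jointly_normal P I X" "finite I" and ij: "i \<in> I" "j \<in> I" "i \<noteq> j"
    and Xi: "distr P borel (X i) = std_normal_distribution"
    and Xj: "distr P borel (X j) = std_normal_distribution"
  defines "r \<equiv> correlation P (X i) (X j)"
  shows "\<bar>r\<bar> \<le> 1"
    and "distr P (borel \<Otimes>\<^sub>M borel) (\<lambda>\<omega>. (X i \<omega>, X j \<omega>)) = bivariate_std_normal r"
proof -
  interpret prob_space P by fact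
  let ?G = std_normal_distribution
  have [measurable]: "X i \<in> borel_measurable P" "X j \<in> borel_measurable P"
    using assms by (auto simp: jointly_normal_def)
  have G: "integrable ?G (\<lambda>x. x)" "integrable ?G (\<lambda>x. x * x)" "(LINT x|?G. x) = 0" "(LINT x|?G. x * x) = 1"
    using integrable_std_normal_distribution_moment[of 1] integrable_std_normal_distribution_moment[of 2]
      integral_std_normal_distribution_moment_odd[of 1] std_normal_distribution_even_moments(1)[of 1]
    by (auto simp: power2_eq_square)
  have m: "integrable P Y \<and> integrable P (\<lambda>\<omega>. Y \<omega> * Y \<omega>) \<and> expectation Y = 0 \<and> expectation (\<lambda>\<omega>. Y \<omega> * Y \<omega>) = 1"
    if [measurable]: "Y \<in> borel_measurable P" and Y: "distr P borel Y = ?G" for Y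
    using G unfolding Y[symmetric]
    by (simp add: integrable_distr_eq integral_distr)
  have mi: "integrable P (X i)" "integrable P (\<lambda>\<omega>. X i \<omega> * X i \<omega>)" "expectation (X i) = 0"
      "expectation (\<lambda>\<omega>. X i \<omega> * X i \<omega>) = 1"
    and mj: "integrable P (X j)" "integrable P (\<lambda>\<omega>. X j \<omega> * X j \<omega>)" "expectation (X j) = 0"
      "expectation (\<lambda>\<omega>. X j \<omega> * X j \<omega>) = 1"
    using m[OF _ Xi] m[OF _ Xj] by auto
  have ip: "integrable P (\<lambda>\<omega>. X i \<omega> * X j \<omega>)"
  proof (rule Bochner_Integration.integrable_bound)
    show "integrable P (\<lambda>\<omega>. X i \<omega> * X i \<omega> + X j \<omega> * X j \<omega>)" using mi mj by simp
    have "2 * \<bar>x * y\<bar> \<le> x * x + y * y" for x y :: real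
      using sum_squares_bound[of "\<bar>x\<bar>" "\<bar>y\<bar>"] by (simp add: abs_mult power2_eq_square)
    then have "\<bar>x * y\<bar> \<le> \<bar>x * x + y * y\<bar>" for x y :: real
      by (smt (verit) abs_ge_zero)
    then show "AE \<omega> in P. norm (X i \<omega> * X j \<omega>) \<le> norm (X i \<omega> * X i \<omega> + X j \<omega> * X j \<omega>)" by simp
  qed simp
  have r: "r = expectation (\<lambda>\<omega>. X i \<omega> * X j \<omega>)"
    using mi mj by (simp add: r_def correlation_def covariance_def)
  have comb: "distr P borel (\<lambda>\<omega>. u * X i \<omega> + v * X j \<omega>) = normal_law 0 (sqrt (u\<^sup>2 + v\<^sup>2 + 2 * r * u * v))
      \<and> 0 \<le> u\<^sup>2 + v\<^sup>2 + 2 * r * u * v" for u v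
  proof -
    let ?L = "\<lambda>\<omega>. u * X i \<omega> + v * X j \<omega>"
    \<comment> \<open>A coefficient vector supported on \<open>i\<close> and \<open>j\<close>
      extracts the combination of just these two coordinates.\<close>
    define a where "a = (\<lambda>k. if k = i then u else if k = j then v else 0)"
    have "(\<Sum>k\<in>I. a k * X k \<omega>) = (\<Sum>k\<in>{i, j}. a k * X k \<omega>)" for \<omega>
      using assms(3) ij by (intro sum.mono_neutral_right) (auto simp: a_def)
    also have "(\<Sum>k\<in>{i, j}. a k * X k \<omega>) = ?L \<omega>" for \<omega>
      using ij by (simp add: a_def)
    finally have "(\<lambda>\<omega>. \<Sum>k\<in>I. a k * X k \<omega>) = ?L" by simp
    moreover obtain \<mu> \<sigma> where \<sigma>: "0 \<le> \<sigma>"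
      and "distr P borel (\<lambda>\<omega>. \<Sum>k\<in>I. a k * X k \<omega>) = normal_law \<mu> \<sigma>"
      using assms(2) unfolding jointly_normal_def by blast
    ultimately have L: "distr P borel ?L = normal_law \<mu> \<sigma>" by simp
    have "\<mu> = (LINT x|distr P borel ?L. x)"
      using integral_normal_law(1)[OF \<sigma>, of \<mu>] by (simp only: L)
    also have "\<dots> = expectation ?L"
      by (subst integral_distr) auto
    also have "\<dots> = 0" using mi mj by simp
    finally have \<mu>: "\<mu> = 0" .
    have "\<sigma>\<^sup>2 = (LINT x|distr P borel ?L. x\<^sup>2)"
      using integral_normal_law(2)[OF \<sigma>, of \<mu>] by (simp only: L \<mu> diff_zero)
    also have "\<dots> = expectation (\<lambda>\<omega>. (?L \<omega>)\<^sup>2)"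
      by (subst integral_distr) auto
    also have "\<dots> = expectation (\<lambda>\<omega>. u\<^sup>2 * (X i \<omega> * X i \<omega>) + v\<^sup>2 * (X j \<omega> * X j \<omega>) + 2 * u * v * (X i \<omega> * X j \<omega>))"
      by (intro Bochner_Integration.integral_cong) (simp_all add: power2_eq_square algebra_simps)
    also have "\<dots> = u\<^sup>2 + v\<^sup>2 + 2 * r * u * v"
      using mi mj ip by (simp add: r)
    finally have s2: "\<sigma>\<^sup>2 = u\<^sup>2 + v\<^sup>2 + 2 * r * u * v" .
    have "\<sigma> = sqrt (u\<^sup>2 + v\<^sup>2 + 2 * r * u * v)" unfolding s2[symmetric] using \<sigma> by simp
    then show ?thesis using L \<mu> s2 zero_le_power2[of \<sigma>] by simp
  qed
  \<comment> \<open>The variances of the sum and the difference, \<open>2 + 2 * r\<close> and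
    \<open>2 - 2 * r\<close>, are nonnegative.\<close>
  show r1: "\<bar>r\<bar> \<le> 1"
    using conjunct2[OF comb[of 1 1]] conjunct2[OF comb[of 1 "-1"]] by simp
  show "distr P (borel \<Otimes>\<^sub>M borel) (\<lambda>\<omega>. (X i \<omega>, X j \<omega>)) = bivariate_std_normal r"
  proof (rule bivariate_std_normal_unique[OF r1])
    show "prob_space (distr P (borel \<Otimes>\<^sub>M borel) (\<lambda>\<omega>. (X i \<omega>, X j \<omega>)))"
      by (rule prob_space_distr) simp
    fix u v
    have "distr (distr P (borel \<Otimes>\<^sub>M borel) (\<lambda>\<omega>. (X i \<omega>, X j \<omega>))) borel (\<lambda>(x, y). u * x + v * y) =
        distr P borel (\<lambda>\<omega>. u * X i \<omega> + v * X j \<omega>)"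
      by (subst distr_distr) (simp_all add: comp_def)
    also have "\<dots> = normal_law 0 (sqrt (u\<^sup>2 + v\<^sup>2 + 2 * r * u * v))"
      by (rule conjunct1[OF comb])
    finally show "distr (distr P (borel \<Otimes>\<^sub>M borel) (\<lambda>\<omega>. (X i \<omega>, X j \<omega>))) borel (\<lambda>(x, y). u * x + v * y) =
        normal_law 0 (sqrt (u\<^sup>2 + v\<^sup>2 + 2 * r * u * v))" .
  qed simp
qed

subsection \<open>Conditioning on the sampling procedure\<close>

lemma subalgebra_sigma_gen:
  assumes "S \<in> M \<rightarrow>\<^sub>M N"
  shows "subalgebra M (sigma_gen M N S)"
  unfolding subalgebra_def sigma_gen_def using assms by (auto dest: sets_image_in_sets[OF refl])

text \<open>Since the conditional mean of the sum is almost surely a constant \<open>m\<close>, the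
  expected conditional variance is the ordinary second moment about \<open>m\<close>, which expands
  into covariances of pairs, diagonal included.\<close>

lemma integral_cond_variance_indicator_sum:
  assumes "prob_space M" "S \<in> M \<rightarrow>\<^sub>M N" "finite I"
    and A: "\<And>i. i \<in> I \<Longrightarrow> A i \<in> sets M"
    and const: "\<And>i. i \<in> I \<Longrightarrow> AE \<omega> in M. real_cond_exp M (sigma_gen M N S) (indicator (A i)) \<omega> = \<alpha>"
  shows "(LINT \<omega>|M. cond_variance M N S (\<lambda>\<omega>. \<Sum>i\<in>I. indicator (A i) \<omega>) \<omega>) =
    (\<Sum>i\<in>I. \<Sum>j\<in>I. measure M (A i \<inter> A j) - \<alpha>\<^sup>2)"
proof -
  interpret prob_space M by fact
  let ?F = "sigma_gen M N S"
  interpret finite_measure_subalgebra M ?F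
    by (simp add: finite_measure_subalgebra_def finite_measure_subalgebra_axioms_def finite_measure_axioms
        subalgebra_sigma_gen assms(2))
  \<comment> \<open>Extension by 0 outside \<open>I\<close> makes every \<open>f i\<close>
    integrable, as \<open>real_cond_exp_sum\<close> is applied with integrability at all
    indices.\<close>
  define f where "f i \<omega> = (if i \<in> I then indicator (A i) \<omega> else 0 :: real)" for i \<omega>
  have fI: "f i = indicator (A i)" if "i \<in> I" for i using that by (simp add: f_def fun_eq_iff)
  have f0: "f i = (\<lambda>_. 0)" if "i \<notin> I" for i using that by (simp add: f_def fun_eq_iff)
  have int: "integrable M (f i)" for i
    using A by (cases "i \<in> I") (auto simp: fI f0 less_top[symmetric] intro!: integrable_real_indicator)
  have mf [measurable]: "f i \<in> borel_measurable M" for i using int by auto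
  let ?X = "\<lambda>\<omega>. \<Sum>i\<in>I. f i \<omega>"
  have X: "(\<lambda>\<omega>. \<Sum>i\<in>I. indicator (A i) \<omega>) = ?X" by (simp add: f_def)
  have p: "prob (A i) = \<alpha>" if "i \<in> I" for i
  proof -
    have "prob (A i) = expectation (f i)" using that A by (simp add: fI)
    also have "\<dots> = expectation (real_cond_exp M ?F (f i))" using real_cond_exp_int(2)[OF int] by simp
    also have "\<dots> = expectation (\<lambda>_. \<alpha>)"
      by (intro integral_cong_AE) (use const[OF that] that in \<open>auto simp: fI\<close>)
    finally show ?thesis by (simp add: prob_space)
  qed
  define m where "m = real (card I) * \<alpha>"
  have "AE \<omega> in M. real_cond_exp M ?F ?X \<omega> = (\<Sum>i\<in>I. real_cond_exp M ?F (f i) \<omega>)"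
    by (rule real_cond_exp_sum[OF int])
  moreover have "AE \<omega> in M. \<forall>i\<in>I. real_cond_exp M ?F (f i) \<omega> = \<alpha>"
    using const \<open>finite I\<close> by (intro AE_finite_allI) (auto simp: fI)
  ultimately have E: "AE \<omega> in M. real_cond_exp M ?F ?X \<omega> = m"
    by eventually_elim (simp add: m_def)
  then have sq: "AE \<omega> in M. (?X \<omega> - real_cond_exp M ?F ?X \<omega>)\<^sup>2 = (?X \<omega> - m)\<^sup>2"
    by eventually_elim simp
  have ff: "integrable M (\<lambda>\<omega>. f i \<omega> * f j \<omega>)" for i j
  proof (rule integrable_const_bound[where B=1])
    show "AE \<omega> in M. norm (f i \<omega> * f j \<omega>) \<le> 1" by (auto simp: f_def indicator_def)
  qed measurable
  have expand: "(?X \<omega> - m)\<^sup>2 = (\<Sum>i\<in>I. \<Sum>j\<in>I. f i \<omega> * f j \<omega> - \<alpha> * f i \<omega> - \<alpha> * f j \<omega> + \<alpha>\<^sup>2)" for \<omega>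
  proof -
    have "?X \<omega> - m = (\<Sum>i\<in>I. f i \<omega> - \<alpha>)" by (simp add: m_def sum_subtractf)
    then show ?thesis
      by (simp only: power2_eq_square sum_product) (simp add: algebra_simps)
  qed
  have sqi: "integrable M (\<lambda>\<omega>. (?X \<omega> - m)\<^sup>2)"
    unfolding expand using int ff by simp
  \<comment> \<open>Integration removes the outer conditional expectation; integrability of the
    squared deviation is inherited from its almost sure version about \<open>m\<close>.\<close>
  have "(LINT \<omega>|M. cond_variance M N S ?X \<omega>) = expectation (\<lambda>\<omega>. (?X \<omega> - real_cond_exp M ?F ?X \<omega>)\<^sup>2)"
    unfolding cond_variance_def
    by (rule real_cond_exp_int(2), rule integrable_cong_AE_imp[OF sqi]) (use sq in auto)
  also have "\<dots> = expectation (\<lambda>\<omega>. (?X \<omega> - m)\<^sup>2)"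
    by (rule integral_cong_AE) (use sq in auto)
  also have "\<dots> = (\<Sum>i\<in>I. \<Sum>j\<in>I. expectation (\<lambda>\<omega>. f i \<omega> * f j \<omega>) - \<alpha> * expectation (f i)
      - \<alpha> * expectation (f j) + \<alpha>\<^sup>2)"
    unfolding expand using int ff by (simp add: prob_space)
  also have "\<dots> = (\<Sum>i\<in>I. \<Sum>j\<in>I. measure M (A i \<inter> A j) - \<alpha>\<^sup>2)"
  proof (intro sum.cong refl)
    fix i j assume ij: "i \<in> I" "j \<in> I"
    have "expectation (\<lambda>\<omega>. f i \<omega> * f j \<omega>) = expectation (indicator (A i \<inter> A j))"
      using ij by (simp add: fI indicator_inter_arith[symmetric])
    then show "expectation (\<lambda>\<omega>. f i \<omega> * f j \<omega>) - \<alpha> * expectation (f i)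
      - \<alpha> * expectation (f j) + \<alpha>\<^sup>2 = measure M (A i \<inter> A j) - \<alpha>\<^sup>2"
      using ij A p by (simp add: fI power2_eq_square)
  qed
  finally show ?thesis unfolding X .
qed

lemma measure_two_sided_tail_std_normal:
  assumes [measurable_cong]: "sets P = sets (\<Pi>\<^sub>M i\<in>I. borel)" and i: "i \<in> I"
    and d: "distr P borel (\<lambda>t. t i) = std_normal_distribution" and c: "0 \<le> c"
  shows "measure P {t \<in> space (\<Pi>\<^sub>M i\<in>I. borel). c < \<bar>t i\<bar>} = 2 * (1 - Phi c)"
proof -
  have "(\<lambda>t. t i) \<in> borel_measurable P" using i by measurable
  then have "measure (distr P borel (\<lambda>t. t i)) {x. c < \<bar>x\<bar>} = measure P {t \<in> space (\<Pi>\<^sub>M i\<in>I. borel). c < \<bar>t i\<bar>}"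
    using sets_eq_imp_space_eq[OF assms(1)]
    by (subst measure_distr) (auto intro!: arg_cong[where f="measure P"])
  then show ?thesis by (simp add: d std_normal_two_sided_tail[OF c])
qed

text \<open>The event depends on two coordinates only, whose joint law is bivariate normal;
  \<open>R_term\<close> is the covariance of the two tail events, so the product of the marginal
  tails is added back.\<close>

lemma measure_joint_two_sided_tail:
  assumes "prob_space P" and sP: "sets P = sets (\<Pi>\<^sub>M i\<in>I. borel)"
    and "jointly_normal P I (\<lambda>i t. t i)" "finite I" "i \<in> I" "j \<in> I" "i \<noteq> j"
    and "distr P borel (\<lambda>t. t i) = std_normal_distribution"
    and "distr P borel (\<lambda>t. t j) = std_normal_distribution"
    and c: "0 \<le> c"
  defines "r \<equiv> correlation P (\<lambda>t. t i) (\<lambda>t. t j)"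
  shows "\<bar>r\<bar> \<le> 1"
    and "measure P {t \<in> space (\<Pi>\<^sub>M i\<in>I. borel). c < \<bar>t i\<bar> \<and> c < \<bar>t j\<bar>} =
      R_term r c + (2 * (1 - Phi c))\<^sup>2"
proof -
  note pair = jointly_normal_pair[OF assms(1,3-9), folded r_def]
  show r: "\<bar>r\<bar> \<le> 1" by (rule pair(1))
  note [measurable_cong] = sP
  have m: "(\<lambda>t. t i) \<in> borel_measurable P" "(\<lambda>t. t j) \<in> borel_measurable P"
    using assms by measurable
  have "{p \<in> space (borel \<Otimes>\<^sub>M borel). c < \<bar>fst p\<bar> \<and> c < \<bar>snd p :: real\<bar>} \<in> sets (borel \<Otimes>\<^sub>M borel)"
    by measurable
  then have "measure (distr P (borel \<Otimes>\<^sub>M borel) (\<lambda>t. (t i, t j))) {p. c < \<bar>fst p\<bar> \<and> c < \<bar>snd p\<bar>} =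
      measure P {t \<in> space (\<Pi>\<^sub>M i\<in>I. borel). c < \<bar>t i\<bar> \<and> c < \<bar>t j\<bar>}"
    using sets_eq_imp_space_eq[OF sP] m
    by (subst measure_distr) (auto intro!: arg_cong[where f="measure P"] simp: space_pair_measure)
  then show "measure P {t \<in> space (\<Pi>\<^sub>M i\<in>I. borel). c < \<bar>t i\<bar> \<and> c < \<bar>t j\<bar>} =
      R_term r c + (2 * (1 - Phi c))\<^sup>2"
    by (simp add: pair(2) R_term_eq_covariance[OF r c] std_normal_two_sided_tail[OF c])
qed

theorem proposition5:
  fixes M :: "'a measure" and N :: "'s measure" and S :: "'a \<Rightarrow> 's"
    and C :: nat and T :: "nat \<Rightarrow> 'a \<Rightarrow> real"
    and K :: "'s \<Rightarrow> (nat \<Rightarrow> real) measure" and \<rho> :: "nat \<Rightarrow> nat \<Rightarrow> 's \<Rightarrow> real"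
    and \<alpha> \<rho>\<^sub>0 c w :: real
  assumes "0 < \<alpha>" "\<alpha> < 1" and "C \<ge> 2" and "0 \<le> \<rho>\<^sub>0" "\<rho>\<^sub>0 \<le> 1"
    and "Phi c = 1 - \<alpha> / 2"
    and "prob_space M"
    and "S \<in> M \<rightarrow>\<^sub>M N"
    and "\<And>i. i \<in> {1..C} \<Longrightarrow> T i \<in> borel_measurable M"
    and "regular_cond_distr M N S (\<Pi>\<^sub>M i\<in>{1..C}. borel) (\<lambda>\<omega>. \<lambda>i\<in>{1..C}. T i \<omega>) K"
    and "AE s in distr M N S. jointly_normal (K s) {1..C} (\<lambda>i t. t i)"
    and "\<And>i. i \<in> {1..C} \<Longrightarrow>
           AE s in distr M N S. distr (K s) borel (\<lambda>t. t i) = std_normal_distribution"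
    and "\<And>i j. i \<in> {1..C} \<Longrightarrow> j \<in> {1..C} \<Longrightarrow> i \<noteq> j \<Longrightarrow> \<rho> i j \<in> borel_measurable N"
    and "\<And>i j. i \<in> {1..C} \<Longrightarrow> j \<in> {1..C} \<Longrightarrow> i \<noteq> j \<Longrightarrow>
           AE s in distr M N S. correlation (K s) (\<lambda>t. t i) (\<lambda>t. t j) = \<rho> i j s"
    and "\<And>i j. i \<in> {1..C} \<Longrightarrow> j \<in> {1..C} \<Longrightarrow> i \<noteq> j \<Longrightarrow>
           measure (distr M N S) {s \<in> space N. \<bar>\<rho> i j s\<bar> \<ge> \<rho>\<^sub>0} \<le> w"
  shows "(LINT \<omega>|M. cond_variance M N S (num_rejections M C T c) \<omega>)
           \<le> real C * \<alpha> * (1 - \<alpha>)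
              + real C * (real C - 1) * (\<alpha> * (1 - \<alpha>) * w + R_term \<rho>\<^sub>0 c)
       \<and> (\<forall>\<gamma>. w = \<gamma> / real (C choose 2) \<longrightarrow>
           (LINT \<omega>|M. cond_variance M N S (num_rejections M C T c) \<omega>)
             \<le> (real C + 2 * \<gamma>) * \<alpha> * (1 - \<alpha>)
                + real C * (real C - 1) * R_term \<rho>\<^sub>0 c)"
proof -
  interpret prob_space M by fact
  let ?I = "{1..C}" and ?F = "sigma_gen M N S"
  let ?L = "\<Pi>\<^sub>M i\<in>{1..C}. (borel :: real measure)"
  interpret finite_measure_subalgebra M ?F
    by (simp add: finite_measure_subalgebra_def finite_measure_subalgebra_axioms_def finite_measure_axioms
        subalgebra_sigma_gen assms(8))
  note [measurable] = assms(8)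
  note T [measurable] = assms(9)
  \<comment> \<open>From \<open>\<alpha> < 1\<close> it follows that \<open>Phi c\<close> exceeds
    1/2.\<close>
  have c: "0 \<le> c" by (rule Phi_nonneg_quantile) (use assms in simp)
  have \<alpha>: "2 * (1 - Phi c) = \<alpha>" using assms(6) by simp
  let ?A = "rejection M T c"
  have A: "?A i \<in> events" if "i \<in> ?I" for i
    unfolding rejection_def using T[OF that] by measurable
  have K: "K \<in> N \<rightarrow>\<^sub>M prob_algebra ?L"
    and cond: "\<And>B. B \<in> sets ?L \<Longrightarrow> AE \<omega> in M.
        real_cond_exp M ?F (indicator ((\<lambda>\<omega>. \<lambda>i\<in>?I. T i \<omega>) -` B \<inter> space M)) \<omega> = measure (K (S \<omega>)) B"
    using assms(10) unfolding regular_cond_distr_def by auto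
  have Ks: "prob_space (K (S \<omega>))" "sets (K (S \<omega>)) = sets ?L" if "\<omega> \<in> space M" for \<omega>
    using measurable_space[OF K measurable_space[OF assms(8) that]] by (auto simp: space_prob_algebra)
  have marg: "AE \<omega> in M. distr (K (S \<omega>)) borel (\<lambda>t. t i) = std_normal_distribution" if "i \<in> ?I" for i
    by (rule AE_distrD[OF assms(8) assms(12)[OF that]])
  let ?B1 = "\<lambda>i. {t \<in> space ?L. c < \<bar>t i\<bar>}"
  let ?B2 = "\<lambda>i j. {t \<in> space ?L. c < \<bar>t i\<bar> \<and> c < \<bar>t j\<bar>}"
  have B1: "?B1 i \<in> sets ?L" if "i \<in> ?I" for i using that by measurable
  have B2: "?B2 i j \<in> sets ?L" if "i \<in> ?I" "j \<in> ?I" for i j using that by measurable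
  have K1: "AE \<omega> in M. measure (K (S \<omega>)) (?B1 i) = \<alpha>" if i: "i \<in> ?I" for i
    using marg[OF i] AE_space
    by eventually_elim (simp only: measure_two_sided_tail_std_normal[OF Ks(2) i _ c] \<alpha>)
  have one: "AE \<omega> in M. real_cond_exp M ?F (indicator (?A i)) \<omega> = \<alpha>" if i: "i \<in> ?I" for i
  proof -
    have "(\<lambda>\<omega>. \<lambda>i\<in>?I. T i \<omega>) -` ?B1 i \<inter> space M = ?A i"
      using i by (auto simp: rejection_def space_PiM)
    then show ?thesis using cond[OF B1[OF i]] K1[OF i] by auto
  qed
  have ind: "integrable M (indicator B :: 'a \<Rightarrow> real)" if "B \<in> events" for B
    using that by (auto simp: less_top[symmetric] intro!: integrable_real_indicator)
  \<comment> \<open>The conditional covariance is bounded separately on the event \<open>?D\<close>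
    of large correlation, of probability at most \<open>w\<close>, and off it; the two bounds are
    then integrated.\<close>
  have two: "prob (?A i \<inter> ?A j) - \<alpha>\<^sup>2 \<le> \<alpha> * (1 - \<alpha>) * w + R_term \<rho>\<^sub>0 c"
    if i: "i \<in> ?I" and j: "j \<in> ?I" and ij: "i \<noteq> j" for i j
  proof -
    note [measurable] = assms(13)[OF i j ij]
    let ?D = "{\<omega> \<in> space M. \<rho>\<^sub>0 \<le> \<bar>\<rho> i j (S \<omega>)\<bar>}"
    have D: "?D \<in> events" by measurable
    have Dw: "prob ?D \<le> w"
    proof -
      have "measure (distr M N S) {s \<in> space N. \<bar>\<rho> i j s\<bar> \<ge> \<rho>\<^sub>0} = prob ?D"
        using measurable_space[OF assms(8)]
        by (subst measure_distr) (auto intro!: arg_cong[where f=prob])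
      then show ?thesis using assms(15)[OF i j ij] by simp
    qed
    have Aij: "?A i \<inter> ?A j \<in> events" using A[OF i] A[OF j] by auto
    have iA: "integrable M (indicator (?A i \<inter> ?A j) :: 'a \<Rightarrow> real)"
      by (rule ind[OF Aij])
    have "(\<lambda>\<omega>. \<lambda>i\<in>?I. T i \<omega>) -` ?B2 i j \<inter> space M = ?A i \<inter> ?A j"
      using i j by (auto simp: rejection_def space_PiM)
    then have "AE \<omega> in M. real_cond_exp M ?F (indicator (?A i \<inter> ?A j)) \<omega> = measure (K (S \<omega>)) (?B2 i j)"
      using cond[OF B2[OF i j]] by simp
    then have bound: "AE \<omega> in M. real_cond_exp M ?F (indicator (?A i \<inter> ?A j)) \<omega> - \<alpha>\<^sup>2 \<le>
        \<alpha> * (1 - \<alpha>) * indicator ?D \<omega> + R_term \<rho>\<^sub>0 c"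
      using marg[OF i] marg[OF j] K1[OF i] AE_distrD[OF assms(8) assms(11)]
        AE_distrD[OF assms(8) assms(14)[OF i j ij]] AE_space
    proof eventually_elim
      case (elim \<omega>)
      let ?P = "K (S \<omega>)"
      interpret P: prob_space ?P by (rule Ks) fact
      note sP = Ks(2)[OF elim(7)]
      note joint = measure_joint_two_sided_tail[OF P.prob_space_axioms sP elim(5) _ i j ij elim(2,3) c,
          unfolded elim(6) \<alpha>]
      \<comment> \<open>On \<open>?D\<close> the joint rejection probability is at most the marginal
        one, so the covariance is at most \<open>\<alpha> - \<alpha>\<^sup>2\<close>, and adding
        \<open>R_term \<rho>\<^sub>0 c\<close> is harmless because it is nonnegative. Off
        \<open>?D\<close> the covariance equals \<open>R_term\<close> at the actual correlation and
        monotonicity applies.\<close>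
      show ?case
      proof (cases "\<omega> \<in> ?D")
        case True
        have "measure ?P (?B2 i j) \<le> measure ?P (?B1 i)"
          by (rule P.finite_measure_mono) (use B1[OF i] sP in auto)
        then show ?thesis
          using True elim(1,4) R_term_nonneg[OF assms(4,5) c] by (simp add: power2_eq_square algebra_simps)
      next
        case False
        then have "\<bar>\<rho> i j (S \<omega>)\<bar> \<le> \<rho>\<^sub>0" using elim(7) by simp
        then show ?thesis
          using False elim(1) joint R_term_mono[OF _ assms(5) c] by simp
      qed
    qed
    have "prob (?A i \<inter> ?A j) - \<alpha>\<^sup>2 = expectation (\<lambda>\<omega>. real_cond_exp M ?F (indicator (?A i \<inter> ?A j)) \<omega> - \<alpha>\<^sup>2)"
      using real_cond_exp_int[OF iA] Aij by (simp add: prob_space)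
    also have "\<dots> \<le> expectation (\<lambda>\<omega>. \<alpha> * (1 - \<alpha>) * indicator ?D \<omega> + R_term \<rho>\<^sub>0 c)"
    proof (intro integral_mono_AE bound)
      show "integrable M (\<lambda>\<omega>. \<alpha> * (1 - \<alpha>) * indicator ?D \<omega> + R_term \<rho>\<^sub>0 c)"
        using ind[OF D] by simp
    qed (use real_cond_exp_int[OF iA] in simp)
    also have "\<dots> = \<alpha> * (1 - \<alpha>) * prob ?D + R_term \<rho>\<^sub>0 c"
      using D ind[OF D] by (simp add: prob_space)
    also have "\<dots> \<le> \<alpha> * (1 - \<alpha>) * w + R_term \<rho>\<^sub>0 c"
      using Dw assms(1,2) by (intro add_right_mono mult_left_mono) auto
    finally show ?thesis .
  qed
  let ?b = "\<alpha> * (1 - \<alpha>) * w + R_term \<rho>\<^sub>0 c"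
  have "(LINT \<omega>|M. cond_variance M N S (num_rejections M C T c) \<omega>) =
      (\<Sum>i\<in>?I. \<Sum>j\<in>?I. prob (?A i \<inter> ?A j) - \<alpha>\<^sup>2)"
    unfolding num_rejections_def[abs_def]
    by (rule integral_cond_variance_indicator_sum) (use assms(7,8) A one in auto)
  \<comment> \<open>The correction replaces the off-diagonal bound \<open>?b\<close> by the variance
    \<open>\<alpha> * (1 - \<alpha>)\<close> on the diagonal, so the double sum evaluates without
    splitting the index set.\<close>
  also have "\<dots> \<le> (\<Sum>i\<in>?I. \<Sum>j\<in>?I. ?b + (if j = i then \<alpha> * (1 - \<alpha>) - ?b else 0))"
  proof (intro sum_mono)
    fix i j assume i: "i \<in> ?I" and j: "j \<in> ?I"
    have "prob (?A i) = \<alpha>"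
    proof -
      have "prob (?A i) = expectation (real_cond_exp M ?F (indicator (?A i)))"
        using real_cond_exp_int(2)[OF ind[OF A[OF i]]] A[OF i] by simp
      also have "\<dots> = expectation (\<lambda>_. \<alpha>)" by (intro integral_cong_AE) (use one[OF i] in auto)
      finally show ?thesis by (simp add: prob_space)
    qed
    then show "prob (?A i \<inter> ?A j) - \<alpha>\<^sup>2 \<le> ?b + (if j = i then \<alpha> * (1 - \<alpha>) - ?b else 0)"
      using two[OF i j] by (cases "j = i") (auto simp: power2_eq_square algebra_simps)
  qed
  also have "\<dots> = real C * \<alpha> * (1 - \<alpha>) + real C * (real C - 1) * ?b"
    by (simp add: sum.distrib) (simp add: algebra_simps)
  finally have main: "(LINT \<omega>|M. cond_variance M N S (num_rejections M C T c) \<omega>)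
      \<le> real C * \<alpha> * (1 - \<alpha>) + real C * (real C - 1) * ?b" .
  have "real C * \<alpha> * (1 - \<alpha>) + real C * (real C - 1) * ?b =
      (real C + 2 * \<gamma>) * \<alpha> * (1 - \<alpha>) + real C * (real C - 1) * R_term \<rho>\<^sub>0 c"
    if \<gamma>: "w = \<gamma> / real (C choose 2)" for \<gamma>
  proof -
    have "real (C choose 2) = real C * (real C - 1) / 2"
      using \<open>C \<ge> 2\<close> by (simp add: choose_two real_of_nat_div of_nat_diff)
    \<comment> \<open>\<open>C \<ge> 2\<close> makes the binomial coefficient nonzero, so the
      division can be undone.\<close>
    moreover have "\<gamma> = w * real (C choose 2)"
      using \<gamma> \<open>C \<ge> 2\<close> by (simp add: binomial_eq_0_iff)
    ultimately have "2 * \<gamma> = real C * (real C - 1) * w" by simp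
    then show ?thesis by (simp only:) (simp add: algebra_simps)
  qed
  with main show ?thesis by auto
qed

end
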